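(* Let $k\ge 1$ and $0\le m\le k$ be integers and let $\varepsilon,\varepsilon_g>0$. For $\ell\in\{0,1,\dots,k+m\}$ define $t_\ell=\frac{\varepsilon_g+\varepsilon(\ell+1-m)}{k-m+1}$ if this number lies in $[0,\varepsilon]$, and otherwise let $t_\ell$ be the point of $\{0,\varepsilon\}$ closest to it. Then $$\delta_{\mathrm{opt}}\Big(\underbrace{\mathcal{M}_{\mathrm{BR}}(\varepsilon)\times\cdots\times\mathcal{M}_{\mathrm{BR}}(\varepsilon)}_{k-m}\times\underbrace{\mathcal{M}_{\mathrm{DP}}(\varepsilon)\times\cdots\times\mathcal{M}_{\mathrm{DP}}(\varepsilon)}_{m};\ \varepsilon_g\Big)$$ $$=\max_{\ell\in\{0,\dots,k+m\}}\ \sum_{i=0}^{k-m}\sum_{j=0}^{m}\binom{k-m}{i}\binom{m}{j}\,q_{2\varepsilon,\varepsilon}^{\,m-j}(1-q_{2\varepsilon,\varepsilon})^{j}\,q_{\varepsilon,t_\ell}^{\,k-m-i}(1-q_{\varepsilon,t_\ell})^{i}\left[1-e^{\varepsilon_g-\varepsilon(m-2j-i)-t_\ell(k-m)}\right]_+ .$$ Furthermore, the same formula holds for every ordering, fixed in advance of any interaction, of the $k-m$ factors $\mathcal{M}_{\mathrm{BR}}(\varepsilon)$ and $m$ factors $\mathcal{M}_{\mathrm{DP}}(\varepsilon)$ in the product.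
   Context: Notation: $[y]_+=\max\{0,y\}$; $0^0=1$; for $\varepsilon>0$ and $t\in[0,\varepsilon]$, $q_{\varepsilon,t}=\frac{1-e^{t-\varepsilon}}{1-e^{-\varepsilon}}$, so that $q_{2\varepsilon,\varepsilon}=\frac{1-e^{-\varepsilon}}{1-e^{-2\varepsilon}}$. Mechanisms are randomized maps $M:\mathcal{X}\to\mathcal{Y}$, where $\mathcal{X}$ carries a symmetric neighboring relation (with at least one pair of distinct neighbors) and $\mathcal{Y}$ is an arbitrary outcome set. $M$ is $(\varepsilon,\delta)$-DP if $\Pr[M(x)\in S]\le e^{\varepsilon}\Pr[M(x')\in S]+\delta$ for all neighbors $x,x'$ and $S\subseteq\mathcal{Y}$; $\varepsilon$-DP means $(\varepsilon,0)$-DP. $M$ is $\varepsilon$-bounded range ($\varepsilon$-BR) if for all neighbors $x,x'$ and outcomes $y_1,y_2$, $\frac{\Pr[M(x)=y_1]}{\Pr[M(x')=y_1]}\le e^{\varepsilon}\frac{\Pr[M(x)=y_2]}{\Pr[M(x')=y_2]}$ (masses or densities). $\mathcal{M}_{\mathrm{DP}}(\varepsilon)$ and $\mathcal{M}_{\mathrm{BR}}(\varepsilon)$ are the classes of all $\varepsilon$-DP and all $\varepsilon$-BR mechanisms. For classes $\mathcal{M}_1,\dots,\mathcal{M}_k$, the non-adaptive composition $\mathcal{M}_1\times\cdots\times\mathcal{M}_k$ is the class of all mechanisms $x\mapsto(M_1(x),\dots,M_k(x))$ with $M_i\in\mathcal{M}_i$ and independent randomness. For $\varepsilon_g\in\mathbb{R}$,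 $\delta_{\mathrm{opt}}(M;\varepsilon_g)=\inf\{\delta\ge0: M\text{ is }(\varepsilon_g,\delta)\text{-DP}\}$, and for a class $\mathcal{M}$, $\delta_{\mathrm{opt}}(\mathcal{M};\varepsilon_g)=\sup_{M\in\mathcal{M}}\delta_{\mathrm{opt}}(M;\varepsilon_g)$. *)

theory Defs
  imports "HOL-Probability.Probability"
begin

text \<open>
  A mechanism maps each input to a probability measure; all these measures live on one common
  measurable space, whose underlying set may be any set of elements of the type \<open>'y\<close>.
  The space may differ from mechanism to mechanism, so different mechanisms can have
  different outcome sets. Events are the measurable sets of that space (all subsets, if the
  \<open>\<sigma>\<close>-algebra is discrete).
\<close>

type_synonym ('x, 'y) mechanism = "'x \<Rightarrow> 'y measure"

definition is_mechanism :: "('x, 'y) mechanism \<Rightarrow> bool" where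
  "is_mechanism M \<longleftrightarrow> (\<exists>Y. \<forall>x. prob_space (M x) \<and> sets (M x) = sets Y)"

definition is_DP :: "('x \<Rightarrow> 'x \<Rightarrow> bool) \<Rightarrow> real \<Rightarrow> real \<Rightarrow> ('x, 'y) mechanism \<Rightarrow> bool" where
  "is_DP nb \<epsilon> \<delta> M \<longleftrightarrow>
     (\<forall>x x'. nb x x' \<longrightarrow>
        (\<forall>S\<in>sets (M x). measure (M x) S \<le> exp \<epsilon> * measure (M x') S + \<delta>))"

text \<open>
  For each pair of neighbors the two output distributions are given by densities with respect to
  some common \<open>\<sigma>\<close>-finite measure \<open>\<mu>\<close>. Such a \<open>\<mu>\<close> always exists (the sum of the two
  distributions), and for a counting measure the densities are the point masses. The inequality
  ranges over the outcomes that are possible under at least one of the two inputs, since otherwise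
  the ratio would be 0/0. In \<^typ>\<open>ennreal\<close> a ratio with positive numerator and zero
  denominator is \<open>\<infinity>\<close>.
\<close>

definition is_BR :: "('x \<Rightarrow> 'x \<Rightarrow> bool) \<Rightarrow> real \<Rightarrow> ('x, 'y) mechanism \<Rightarrow> bool" where
  "is_BR nb \<epsilon> M \<longleftrightarrow>
     (\<forall>x x'. nb x x' \<longrightarrow>
        (\<exists>\<mu> f g. sigma_finite_measure \<mu> \<and>
           f \<in> borel_measurable \<mu> \<and> g \<in> borel_measurable \<mu> \<and>
           M x = density \<mu> f \<and> M x' = density \<mu> g \<and>
           (\<forall>y1\<in>{y\<in>space \<mu>. f y \<noteq> 0 \<or> g y \<noteq> 0}. \<forall>y2\<in>{y\<in>space \<mu>. f y \<noteq> 0 \<or> g y \<noteq> 0}.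
              f y1 / g y1 \<le> ennreal (exp \<epsilon>) * (f y2 / g y2))))"

definition DP_class :: "('x \<Rightarrow> 'x \<Rightarrow> bool) \<Rightarrow> real \<Rightarrow> ('x, 'y) mechanism set" where
  "DP_class nb \<epsilon> = {M. is_mechanism M \<and> is_DP nb \<epsilon> 0 M}"

definition BR_class :: "('x \<Rightarrow> 'x \<Rightarrow> bool) \<Rightarrow> real \<Rightarrow> ('x, 'y) mechanism set" where
  "BR_class nb \<epsilon> = {M. is_mechanism M \<and> is_BR nb \<epsilon> M}"

text \<open>Independence of the components is expressed by the product measure.\<close>

definition composition :: "('x, 'y) mechanism set list \<Rightarrow> ('x, nat \<Rightarrow> 'y) mechanism set" where
  "composition Cs =
     {(\<lambda>x. PiM {..<length Cs} (\<lambda>i. Ms i x)) | Ms. \<forall>i<length Cs. Ms i \<in> Cs ! i}"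

text \<open>
  The infimum is over a nonempty set when \<open>M\<close> is a mechanism, because \<open>\<delta> = 1\<close> is
  always admissible; hence the supremum below is over values in [0,1].
\<close>

definition delta_opt :: "('x \<Rightarrow> 'x \<Rightarrow> bool) \<Rightarrow> ('x, 'y) mechanism \<Rightarrow> real \<Rightarrow> real" where
  "delta_opt nb M \<epsilon>g = Inf {\<delta>. 0 \<le> \<delta> \<and> is_DP nb \<epsilon>g \<delta> M}"

definition delta_opt_class :: "('x \<Rightarrow> 'x \<Rightarrow> bool) \<Rightarrow> ('x, 'y) mechanism set \<Rightarrow> real \<Rightarrow> real" where
  "delta_opt_class nb C \<epsilon>g = (SUP M\<in>C. delta_opt nb M \<epsilon>g)"

definition q :: "real \<Rightarrow> real \<Rightarrow> real" where
  "q \<epsilon> t = (1 - exp (t - \<epsilon>)) / (1 - exp (- \<epsilon>))"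

definition t_pt :: "nat \<Rightarrow> nat \<Rightarrow> real \<Rightarrow> real \<Rightarrow> nat \<Rightarrow> real" where
  "t_pt k m \<epsilon> \<epsilon>g l =
     (let \<tau> = (\<epsilon>g + \<epsilon> * (real l + 1 - real m)) / (real k - real m + 1)
      in if \<tau> \<in> {0..\<epsilon>} then \<tau> else if dist \<tau> 0 \<le> dist \<tau> \<epsilon> then 0 else \<epsilon>)"

definition comp_delta :: "nat \<Rightarrow> nat \<Rightarrow> real \<Rightarrow> real \<Rightarrow> real \<Rightarrow> real" where
  "comp_delta k m \<epsilon> \<epsilon>g t =
     (\<Sum>i=0..k - m. \<Sum>j=0..m.
        real ((k - m) choose i) * real (m choose j) *
        q (2 * \<epsilon>) \<epsilon> ^ (m - j) * (1 - q (2 * \<epsilon>) \<epsilon>) ^ j *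
        q \<epsilon> t ^ (k - m - i) * (1 - q \<epsilon> t) ^ i *
        max 0 (1 - exp (\<epsilon>g - \<epsilon> * (real m - 2 * real j - real i) - t * (real k - real m))))"

end

theory Submission
  imports Defs "HOL-Combinatorics.Permutations"
begin

text \<open>
  Fix two neighbors. A pure DP or bounded-range mechanism yields output distributions \<open>P\<close>, \<open>Q\<close>
  whose likelihood ratio lies in an interval \<open>[exp (t - r), exp t]\<close>, with \<open>r = 2\<epsilon>\<close>, \<open>t = \<epsilon>\<close> for
  DP and \<open>r = \<epsilon>\<close>, \<open>0 \<le> t \<le> \<epsilon>\<close> for bounded range. The optimal \<open>\<delta>\<close> of a product is the
  \<open>Q\<close>-expectation of \<open>max 0 (\<Prod>h\<^sub>i - exp \<epsilon>g)\<close>, where the ratios \<open>h\<^sub>i\<close> are independent of mean 1.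
  This function is convex in each \<open>h\<^sub>i\<close>, so the worst case is a two-point distribution on the end
  points of the interval, that is, randomized response. By convexity again, replacing two of the
  parameters \<open>t\<^sub>i\<close> of the bounded-range factors by a more balanced pair with the same sum does not
  decrease \<open>\<delta>\<close>, so all of them may be taken equal to one \<open>t\<close>. The resulting function of \<open>t\<close> is
  the maximum over \<open>l\<close> of its truncations to the outcomes with \<open>2j + i \<le> l\<close>, and the derivative
  of the \<open>l\<close>-th truncation changes sign at most once, at the unclamped value of \<open>t\<^sub>l\<close>.
\<close>

subsection \<open>Expectations over independent two-point distributions\<close>

text \<open>The expectation of \<open>\<phi>\<close> at a product of independent variables, the
  \<open>i\<close>-th being \<open>b i\<close> with probability \<open>w i\<close> and
  \<open>a i\<close> otherwise; \<open>S\<close> collects the indices at the upper value. The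
  explicit finite sum is affine in each \<open>w i\<close>, so weights depending on a random outcome
  can later be integrated coordinate by coordinate.\<close>

definition two_point_exp ::
    "'i set \<Rightarrow> ('i \<Rightarrow> real) \<Rightarrow> ('i \<Rightarrow> real) \<Rightarrow> ('i \<Rightarrow> real) \<Rightarrow> (real \<Rightarrow> real) \<Rightarrow> real" where
  "two_point_exp I w a b \<phi> =
     (\<Sum>S\<in>Pow I. (\<Prod>i\<in>I. if i \<in> S then w i else 1 - w i) * \<phi> (\<Prod>i\<in>I. if i \<in> S then b i else a i))"

lemma two_point_exp_empty [simp]: "two_point_exp {} w a b \<phi> = \<phi> 1"
  by (simp add: two_point_exp_def)

text \<open>Conditioning on coordinate \<open>i\<close>: each subset of \<open>insert i I\<close> is
  a subset of \<open>I\<close> or such a subset with \<open>i\<close> added. The value of the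
  coordinate moves into the argument of \<open>\<phi>\<close>, which is why inductions over
  \<open>I\<close> keep \<open>\<phi>\<close> arbitrary.\<close>

lemma two_point_exp_insert:
  assumes "finite I" "i \<notin> I"
  shows "two_point_exp (insert i I) w a b \<phi> =
    w i * two_point_exp I w a b (\<lambda>z. \<phi> (b i * z)) + (1 - w i) * two_point_exp I w a b (\<lambda>z. \<phi> (a i * z))"
proof -
  let ?f = "\<lambda>S. (\<Prod>j\<in>insert i I. if j \<in> S then w j else 1 - w j) *
    \<phi> (\<Prod>j\<in>insert i I. if j \<in> S then b j else a j)"
  have *: "(\<Prod>j\<in>I. if j = i \<or> j \<in> S then u j else v j) = (\<Prod>j\<in>I. if j \<in> S then u j else v j)"
    for S and u v :: "'a \<Rightarrow> real"
    using assms by (intro prod.cong) auto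
  have "inj_on (insert i) (Pow I)"
    using assms(2) by (intro inj_on_inverseI[where g = "\<lambda>S. S - {i}"]) auto
  moreover have "Pow I \<inter> insert i ` Pow I = {}"
    using assms(2) by blast
  ultimately have "sum ?f (Pow (insert i I)) = sum ?f (Pow I) + sum (?f \<circ> insert i) (Pow I)"
    using assms(1) by (simp add: Pow_insert sum.union_disjoint sum.reindex)
  moreover have "sum ?f (Pow I) = (1 - w i) * two_point_exp I w a b (\<lambda>z. \<phi> (a i * z))"
    unfolding two_point_exp_def sum_distrib_left using assms
    by (intro sum.cong) (auto simp: mult_ac)
  moreover have "sum (?f \<circ> insert i) (Pow I) = w i * two_point_exp I w a b (\<lambda>z. \<phi> (b i * z))"
    unfolding two_point_exp_def sum_distrib_left using assms
    by (intro sum.cong) (auto simp: mult_ac *)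
  ultimately show ?thesis
    by (simp add: two_point_exp_def)
qed

lemma two_point_exp_cong:
  assumes "\<And>i. i \<in> I \<Longrightarrow> w i = w' i \<and> a i = a' i \<and> b i = b' i"
  shows "two_point_exp I w a b \<phi> = two_point_exp I w' a' b' \<phi>"
  using assms unfolding two_point_exp_def
  by (intro sum.cong refl arg_cong2[where f = "(*)"] arg_cong[where f = \<phi>] prod.cong) auto

lemma two_point_exp_mono:
  assumes "\<And>i. i \<in> I \<Longrightarrow> 0 \<le> w i \<and> w i \<le> 1" "\<And>z. \<phi> z \<le> \<psi> z"
  shows "two_point_exp I w a b \<phi> \<le> two_point_exp I w a b \<psi>"
  unfolding two_point_exp_def using assms
  by (intro sum_mono mult_left_mono prod_nonneg) auto

lemma two_point_exp_add:
  "two_point_exp I w a b (\<lambda>z. \<phi> z + \<psi> z) = two_point_exp I w a b \<phi> + two_point_exp I w a b \<psi>"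
  unfolding two_point_exp_def by (simp add: distrib_left sum.distrib)

lemma two_point_exp_scale:
  "two_point_exp I w a b (\<lambda>z. c * \<phi> z) = c * two_point_exp I w a b \<phi>"
  unfolding two_point_exp_def by (simp add: sum_distrib_left mult_ac)

lemma two_point_exp_union:
  assumes "finite I" "finite J" "I \<inter> J = {}"
  shows "two_point_exp (I \<union> J) w a b \<phi> =
    two_point_exp I w a b (\<lambda>u. two_point_exp J w a b (\<lambda>v. \<phi> (u * v)))"
  using assms
proof (induction I arbitrary: \<phi> rule: finite_induct)
  case (insert i I)
  then show ?case
    by (simp add: two_point_exp_insert mult.assoc)
qed simp

section \<open>Convex functions of a product\<close>

lemma convex_on_scale:
  fixes \<phi> :: "real \<Rightarrow> real"
  assumes "convex_on UNIV \<phi>"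
  shows "convex_on UNIV (\<lambda>z. \<phi> (r * z))"
proof (intro convex_onI)
  fix t x y :: real
  assume "0 < t" "t < 1"
  then show "\<phi> (r * ((1 - t) *\<^sub>R x + t *\<^sub>R y)) \<le> (1 - t) * \<phi> (r * x) + t * \<phi> (r * y)"
    using convex_onD[OF assms, of t "r * x" "r * y"] by (simp add: algebra_simps)
qed simp

lemma convex_on_pos_part: "convex_on UNIV (\<lambda>z::real. max 0 (z - c))"
proof (intro convex_onI)
  fix t x y :: real
  assume t: "0 < t" "t < 1"
  have "(1 - t) *\<^sub>R x + t *\<^sub>R y - c = (1 - t) * (x - c) + t * (y - c)"
    by (simp add: algebra_simps)
  moreover have "(1 - t) * (x - c) \<le> (1 - t) * max 0 (x - c)" "t * (y - c) \<le> t * max 0 (y - c)"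
    "0 \<le> (1 - t) * max 0 (x - c)" "0 \<le> t * max 0 (y - c)"
    using t by (auto intro!: mult_left_mono)
  ultimately show "max 0 ((1 - t) *\<^sub>R x + t *\<^sub>R y - c) \<le> (1 - t) * max 0 (x - c) + t * max 0 (y - c)"
    by linarith
qed simp

text \<open>The weight expresses \<open>h\<close> as a convex combination of \<open>a\<close> and
  \<open>b\<close>, and multiplication by \<open>z\<close> preserves this for either sign of
  \<open>z\<close>; convexity on the whole line then applies.\<close>

lemma convex_chord:
  fixes \<phi> :: "real \<Rightarrow> real"
  assumes "convex_on UNIV \<phi>" "a < b" "a \<le> h" "h \<le> b"
  shows "\<phi> (h * z) \<le> (h - a) / (b - a) * \<phi> (b * z) + (1 - (h - a) / (b - a)) * \<phi> (a * z)"
proof -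
  let ?t = "(h - a) / (b - a)"
  have "(1 - ?t) * (a * z) + ?t * (b * z) = h * z"
  proof -
    have "?t * (b - a) = h - a"
      using assms(2) by simp
    then have "(a + ?t * (b - a)) * z = h * z"
      by simp
    then show ?thesis
      by (simp only: algebra_simps)
  qed
  moreover have "0 \<le> ?t" "?t \<le> 1"
    using assms by (auto simp: divide_simps)
  ultimately show ?thesis
    using convex_onD[OF assms(1), of ?t "a * z" "b * z"] by simp
qed

text \<open>The chord bound is applied to one factor at a time, the others acting as a scaling. The
  resulting weights are affine in the \<open>h i\<close>, so after integration over independent
  \<open>h i\<close> only their means remain.\<close>

lemma convex_prod_le_two_point_exp:
  assumes "finite I" "convex_on UNIV \<phi>"
    and "\<And>i. i \<in> I \<Longrightarrow> a i < b i \<and> a i \<le> h i \<and> h i \<le> b i"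
  shows "\<phi> (\<Prod>i\<in>I. h i) \<le> two_point_exp I (\<lambda>i. (h i - a i) / (b i - a i)) a b \<phi>"
  using assms
proof (induction I arbitrary: \<phi> rule: finite_induct)
  case (insert i I)
  let ?l = "\<lambda>i. (h i - a i) / (b i - a i)"
  have "\<phi> (\<Prod>i\<in>insert i I. h i) \<le> two_point_exp I ?l a b (\<lambda>z. \<phi> (h i * z))"
    using insert.IH[of "\<lambda>z. \<phi> (h i * z)"] insert.hyps insert.prems by (simp add: convex_on_scale)
  also have "\<dots> \<le> two_point_exp I ?l a b (\<lambda>z. ?l i * \<phi> (b i * z) + (1 - ?l i) * \<phi> (a i * z))"
    using insert.prems by (intro two_point_exp_mono convex_chord) (auto simp: divide_simps)
  also have "\<dots> = two_point_exp (insert i I) ?l a b \<phi>"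
    by (simp only: two_point_exp_add two_point_exp_scale two_point_exp_insert[OF insert.hyps])
  finally show ?case .
qed simp

text \<open>The equality case of the chord bound: at an end point each weight is \<open>0\<close> or
  \<open>1\<close>. It shows that two-valued likelihood ratios are extremal.\<close>

lemma prod_eq_two_point_exp:
  assumes "finite I" "\<And>i. i \<in> I \<Longrightarrow> a i < b i \<and> h i \<in> {a i, b i}"
  shows "\<phi> (\<Prod>i\<in>I. h i) = two_point_exp I (\<lambda>i. (h i - a i) / (b i - a i)) a b \<phi>"
  using assms
proof (induction I arbitrary: \<phi> rule: finite_induct)
  case (insert i I)
  let ?E = "two_point_exp I (\<lambda>i. (h i - a i) / (b i - a i)) a b"
  have IH: "\<phi> (h i * (\<Prod>j\<in>I. h j)) = ?E (\<lambda>z. \<phi> (h i * z))"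
    by (rule insert.IH[of "\<lambda>z. \<phi> (h i * z)"]) (use insert.prems in auto)
  consider "h i = a i" "(h i - a i) / (b i - a i) = 0" | "h i = b i" "(h i - a i) / (b i - a i) = 1"
    using insert.prems[of i] by auto
  then have "(h i - a i) / (b i - a i) * ?E (\<lambda>z. \<phi> (b i * z))
      + (1 - (h i - a i) / (b i - a i)) * ?E (\<lambda>z. \<phi> (a i * z)) = ?E (\<lambda>z. \<phi> (h i * z))"
    by cases (simp_all only: mult_1_left mult_zero_left add_0_left add_0_right diff_self diff_zero)
  then show ?case
    by (simp only: two_point_exp_insert[OF insert.hyps] IH prod.insert[OF insert.hyps])
qed simp

text \<open>Subsets are grouped by cardinality. The final reindexing makes \<open>i\<close> count
  the coordinates at the lower value \<open>a\<close>, as in \<open>comp_delta\<close>.\<close>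

lemma two_point_exp_const:
  assumes "finite I" "card I = n"
  shows "two_point_exp I (\<lambda>_. w) (\<lambda>_. a) (\<lambda>_. b) \<phi> =
    (\<Sum>i\<le>n. real (n choose i) * w ^ (n - i) * (1 - w) ^ i * \<phi> (b ^ (n - i) * a ^ i))"
proof -
  have *: "(\<Prod>i\<in>I. if i \<in> S then u else v) = u ^ card S * v ^ (n - card S)"
    if "S \<subseteq> I" for S and u v :: real
  proof -
    have "finite S"
      using that assms(1) finite_subset by blast
    then show ?thesis
      using that assms by (simp add: prod.If_cases Int_absorb1 Diff_eq[symmetric] card_Diff_subset)
  qed
  have "two_point_exp I (\<lambda>_. w) (\<lambda>_. a) (\<lambda>_. b) \<phi> =
    (\<Sum>S\<in>Pow I. w ^ card S * (1 - w) ^ (n - card S) * \<phi> (b ^ card S * a ^ (n - card S)))"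
    unfolding two_point_exp_def by (intro sum.cong refl) (simp add: *)
  also have "\<dots> = (\<Sum>i\<le>n. \<Sum>S\<in>{S \<in> Pow I. card S = i}.
      w ^ card S * (1 - w) ^ (n - card S) * \<phi> (b ^ card S * a ^ (n - card S)))"
    using assms by (intro sum.group[symmetric]) (auto simp: card_mono)
  also have "\<dots> = (\<Sum>i\<le>n. real (n choose i) * w ^ i * (1 - w) ^ (n - i) * \<phi> (b ^ i * a ^ (n - i)))"
    using assms by (intro sum.cong refl) (simp add: n_subsets)
  also have "\<dots> = (\<Sum>i\<le>n. real (n choose i) * w ^ (n - i) * (1 - w) ^ i * \<phi> (b ^ (n - i) * a ^ i))"
    by (rule sum.reindex_bij_witness[of _ "\<lambda>i. n - i" "\<lambda>i. n - i"])
      (auto simp: binomial_symmetric[symmetric])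
  finally show ?thesis .
qed

subsection \<open>Hockey-stick divergence of product measures\<close>

text \<open>The upper bound gives absolute continuity, hence a Radon-Nikodym density. The setwise
  bounds hold for it almost everywhere, and clamping makes them hold at every point.\<close>

lemma density_eq_bounds:
  assumes "prob_space P" "prob_space Q" "sets P = sets Q" "0 \<le> a" "a \<le> b"
    and "\<And>S. S \<in> sets Q \<Longrightarrow> a * measure Q S \<le> measure P S \<and> measure P S \<le> b * measure Q S"
  obtains h :: "'a \<Rightarrow> real" where "h \<in> borel_measurable Q" "\<And>y. a \<le> h y \<and> h y \<le> b"
    "P = density Q (\<lambda>y. ennreal (h y))"
proof -
  interpret P: prob_space P by fact
  interpret Q: prob_space Q by fact
  have em: "ennreal a * emeasure Q S \<le> emeasure P S" "emeasure P S \<le> ennreal b * emeasure Q S"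
    if "S \<in> sets Q" for S
    using assms(4,5) assms(6)[OF that]
    by (auto simp: P.emeasure_eq_measure Q.emeasure_eq_measure simp flip: ennreal_mult
        intro!: ennreal_leI)
  have "absolutely_continuous Q P"
    unfolding absolutely_continuous_def
  proof
    fix S assume "S \<in> null_sets Q"
    then show "S \<in> null_sets P"
      using em(2)[of S] assms(3) by (auto simp: null_sets_def)
  qed
  then obtain f where f [measurable]: "f \<in> borel_measurable Q" and P: "density Q f = P"
    using Q.Radon_Nikodym assms(3) by blast
  \<comment> \<open>If the order failed on a set of positive measure, the event
    \<open>v x < u x\<close> would carry strictly more of \<open>u\<close> than of \<open>v\<close>;
    finiteness of the integral of \<open>v\<close> is what makes the comparison strict.\<close>
  have le: "AE x in Q. u x \<le> v x"
    if [measurable]: "u \<in> borel_measurable Q" "v \<in> borel_measurable Q"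
      and "\<And>S. S \<in> sets Q \<Longrightarrow> (\<integral>\<^sup>+x. u x * indicator S x \<partial>Q) \<le> (\<integral>\<^sup>+x. v x * indicator S x \<partial>Q)"
      and fin: "(\<integral>\<^sup>+x. v x \<partial>Q) < \<infinity>"
    for u v :: "'a \<Rightarrow> ennreal"
  proof (rule ccontr)
    let ?S = "{x \<in> space Q. v x < u x}"
    assume *: "\<not> (AE x in Q. u x \<le> v x)"
    have "(\<integral>\<^sup>+x. v x * indicator ?S x \<partial>Q) \<le> (\<integral>\<^sup>+x. v x \<partial>Q)"
      by (intro nn_integral_mono) (auto simp: indicator_def)
    moreover have "AE x in Q. v x * indicator ?S x \<le> u x * indicator ?S x"
      by (auto simp: indicator_def)
    moreover have "\<not> (AE x in Q. u x * indicator ?S x \<le> v x * indicator ?S x)"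
    proof
      assume "AE x in Q. u x * indicator ?S x \<le> v x * indicator ?S x"
      then have "AE x in Q. u x \<le> v x"
        using AE_space
      proof eventually_elim
        case (elim x)
        then show ?case
          by (cases "v x < u x") auto
      qed
      with * show False ..
    qed
    ultimately have "(\<integral>\<^sup>+x. v x * indicator ?S x \<partial>Q) < (\<integral>\<^sup>+x. u x * indicator ?S x \<partial>Q)"
      using fin by (intro nn_integral_less) (auto simp: top_unique less_top)
    then show False
      using that(3)[of ?S] by auto
  qed
  have ef: "(\<integral>\<^sup>+x. f x * indicator S x \<partial>Q) = emeasure P S" if "S \<in> sets Q" for S
    using that by (simp add: emeasure_density flip: P)
  have lo: "AE x in Q. ennreal a \<le> f x"
  proof (rule le)
    show "(\<integral>\<^sup>+x. f x \<partial>Q) < \<infinity>"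
      using ef[OF sets.top] by (simp add: nn_integral_indicator_finite cong: nn_integral_cong)
        (metis P.emeasure_space_1 assms(3) ennreal_one_less_top sets_eq_imp_space_eq)
  qed (simp_all add: ef em nn_integral_cmult_indicator)
  have hi: "AE x in Q. f x \<le> ennreal b"
    by (rule le) (simp_all add: ef em nn_integral_cmult_indicator Q.emeasure_space_1)
  \<comment> \<open>Clamping changes \<open>f\<close> only on a null set.\<close>
  let ?h = "\<lambda>y. max a (min b (enn2real (f y)))"
  have "AE y in Q. f y = ennreal (?h y)"
    using lo hi
  proof eventually_elim
    case (elim y)
    then obtain r where "f y = ennreal r" "0 \<le> r"
      by (cases "f y") (auto simp: top_unique)
    with elim assms(4,5) show ?case
      by (auto simp: max_def min_def)
  qed
  then have "P = density Q (\<lambda>y. ennreal (?h y))"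
    unfolding P[symmetric] by (intro density_cong) auto
  with assms(4,5) show thesis
    by (intro that[of ?h]) auto
qed

text \<open>Both measures agree on rectangles, since the integral of a product of one-coordinate
  functions factors. The hypotheses range over all indices because \<open>product_prob_space\<close>
  is stated for whole families.\<close>

lemma PiM_density:
  assumes "finite I" "\<And>i. prob_space (Q i)" "\<And>i. prob_space (density (Q i) (h i))"
    and [measurable]: "\<And>i. h i \<in> borel_measurable (Q i)"
  shows "PiM I (\<lambda>i. density (Q i) (h i)) = density (PiM I Q) (\<lambda>y. \<Prod>i\<in>I. h i (y i))"
proof -
  interpret D: product_prob_space "\<lambda>i. density (Q i) (h i)"
    using assms(3) by (simp add: product_prob_space_def product_prob_space_axioms_def
        product_sigma_finite_def prob_space_imp_sigma_finite)
  interpret Q: product_prob_space Q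
    using assms(2) by (simp add: product_prob_space_def product_prob_space_axioms_def
        product_sigma_finite_def prob_space_imp_sigma_finite)
  show ?thesis
  proof (rule D.PiM_eqI[symmetric])
    show "sets (density (PiM I Q) (\<lambda>y. \<Prod>i\<in>I. h i (y i))) = sets (PiM I (\<lambda>i. density (Q i) (h i)))"
      by (auto cong: sets_PiM_cong)
    fix A assume "\<And>i. i \<in> I \<Longrightarrow> A i \<in> sets (density (Q i) (h i))"
    then have A [measurable]: "\<And>i. i \<in> I \<Longrightarrow> A i \<in> sets (Q i)"
      by simp
    have "emeasure (density (PiM I Q) (\<lambda>y. \<Prod>i\<in>I. h i (y i))) (Pi\<^sub>E I A)
        = (\<integral>\<^sup>+y. (\<Prod>i\<in>I. h i (y i)) * indicator (Pi\<^sub>E I A) y \<partial>PiM I Q)"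
      using assms(1) A by (intro emeasure_density sets_PiM_I_finite) auto
    also have "\<dots> = (\<integral>\<^sup>+y. (\<Prod>i\<in>I. h i (y i) * indicator (A i) (y i)) \<partial>PiM I Q)"
    proof (rule nn_integral_cong)
      fix y assume "y \<in> space (PiM I Q)"
      then have "indicator (Pi\<^sub>E I A) y = (\<Prod>i\<in>I. indicator (A i) (y i) :: ennreal)"
        using assms(1) by (auto simp: space_PiM indicator_def PiE_iff prod_zero_iff)
      then show "(\<Prod>i\<in>I. h i (y i)) * indicator (Pi\<^sub>E I A) y
          = (\<Prod>i\<in>I. h i (y i) * indicator (A i) (y i))"
        by (simp add: prod.distrib)
    qed
    also have "\<dots> = (\<Prod>i\<in>I. \<integral>\<^sup>+y. h i y * indicator (A i) y \<partial>Q i)"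
      using assms(1) by (intro Q.product_nn_integral_prod) auto
    also have "\<dots> = (\<Prod>i\<in>I. emeasure (density (Q i) (h i)) (A i))"
      using A by (intro prod.cong refl) (simp add: emeasure_density)
    finally show "emeasure (density (PiM I Q) (\<lambda>y. \<Prod>i\<in>I. h i (y i))) (Pi\<^sub>E I A)
        = (\<Prod>i\<in>I. emeasure (density (Q i) (h i)) (A i))" .
  qed fact
qed

text \<open>The situation for one pair of neighbors: \<open>Q i\<close> is the output distribution
  of the \<open>i\<close>-th factor on one input, and \<open>h i\<close> is the likelihood ratio
  that yields its distribution on the other. Below, \<open>weight i\<close> is the probability of
  \<open>b i\<close> in the distribution on \<open>a i\<close> and \<open>b i\<close> with mean
  1.\<close>

locale bounded_densities =
  fixes I :: "'i set" and Q :: "'i \<Rightarrow> 'a measure" and h :: "'i \<Rightarrow> 'a \<Rightarrow> real"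
    and a b :: "'i \<Rightarrow> real"
  assumes finite_I [simp]: "finite I"
    and prob_Q: "\<And>i. prob_space (Q i)"
    and prob_density: "\<And>i. prob_space (density (Q i) (\<lambda>y. ennreal (h i y)))"
    and measurable_h [measurable]: "\<And>i. h i \<in> borel_measurable (Q i)"
    and bounds: "\<And>i. 0 \<le> a i \<and> a i < b i"
    and h_bounds: "\<And>i y. a i \<le> h i y \<and> h i y \<le> b i"
begin

sublocale product_prob_space Q I
  using prob_Q by (simp add: product_prob_space_def product_prob_space_axioms_def
      product_sigma_finite_def prob_space_imp_sigma_finite)

abbreviation "QQ \<equiv> PiM I Q"
abbreviation "PP \<equiv> PiM I (\<lambda>i. density (Q i) (\<lambda>y. ennreal (h i y)))"
abbreviation "H y \<equiv> \<Prod>i\<in>I. h i (y i)"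
abbreviation "weight i \<equiv> (1 - a i) / (b i - a i)"

lemma integrable_h: "integrable (Q i) (h i)"
proof -
  have "\<bar>h i y\<bar> \<le> b i" for y
    using bounds[of i] h_bounds[of i y] by linarith
  then show ?thesis
    by (intro finite_measure.integrable_const_bound[where B = "b i"]
        prob_space.finite_measure prob_Q) auto
qed

lemma integral_h: "(\<integral>y. h i y \<partial>Q i) = 1"
proof -
  have "emeasure (density (Q i) (\<lambda>y. ennreal (h i y))) (space (Q i)) = 1"
    using prob_space.emeasure_space_1[OF prob_density[of i]] by simp
  then have "(\<integral>\<^sup>+y. ennreal (h i y) \<partial>Q i) = 1"
    by (simp add: emeasure_density cong: nn_integral_cong_simp)
  moreover have "0 \<le> h i y" for y
    using bounds[of i] h_bounds[of i y] by linarith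
  ultimately show ?thesis
    by (simp add: integral_eq_nn_integral)
qed

text \<open>Each summand is a product of functions of separate coordinates, so independence factors
  its integral. Each function is affine in \<open>h i\<close>, whose mean is 1; this replaces
  \<open>h i\<close> by 1 in the weights.\<close>

lemma
  shows integrable_two_point_exp:
    "integrable QQ (\<lambda>y. two_point_exp I (\<lambda>i. (h i (y i) - a i) / (b i - a i)) a b \<phi>)" (is ?A)
  and integral_two_point_exp:
    "(\<integral>y. two_point_exp I (\<lambda>i. (h i (y i) - a i) / (b i - a i)) a b \<phi> \<partial>QQ)
    = two_point_exp I weight a b \<phi>" (is ?B)
proof -
  define g where "g S i y = (if i \<in> S then (h i y - a i) / (b i - a i) else 1 - (h i y - a i) / (b i - a i))"
    for S i y
  have ig: "integrable (Q i) (g S i)" for S i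
    unfolding g_def using integrable_h[of i] by (cases "i \<in> S") auto
  have g: "(\<integral>y. g S i y \<partial>Q i) = (if i \<in> S then weight i else 1 - weight i)" for S i
    unfolding g_def using integrable_h[of i] integral_h[of i]
    by (cases "i \<in> S") (auto simp: prob_space.prob_space[OF prob_Q])
  have *: "two_point_exp I (\<lambda>i. (h i (y i) - a i) / (b i - a i)) a b \<phi> =
    (\<Sum>S\<in>Pow I. (\<Prod>i\<in>I. g S i (y i)) * \<phi> (\<Prod>i\<in>I. if i \<in> S then b i else a i))" for y
    by (simp add: two_point_exp_def g_def)
  have ip: "integrable QQ (\<lambda>y. \<Prod>i\<in>I. g S i (y i))" for S
    by (intro product_integrable_prod ig) simp
  then show ?A
    unfolding * by auto
  show ?B
    unfolding * using ip
    by (simp add: product_integral_prod[OF finite_I ig] g two_point_exp_def)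
qed

lemma H_bounds: "0 \<le> H y" "H y \<le> (\<Prod>i\<in>I. b i)"
proof -
  have "0 \<le> h i (y i)" "h i (y i) \<le> b i" for i
    using bounds[of i] h_bounds[of i "y i"] by linarith+
  then show "0 \<le> H y" "H y \<le> (\<Prod>i\<in>I. b i)"
    by (auto intro!: prod_nonneg prod_mono)
qed

lemma measurable_H [measurable]: "H \<in> borel_measurable QQ"
  by measurable

lemma sets_PP: "sets PP = sets QQ"
  by (auto cong: sets_PiM_cong)

lemma integrable_H:
  assumes [measurable]: "S \<in> sets QQ"
  shows "integrable QQ (\<lambda>y. indicator S y * (H y - c))"
proof -
  have "\<bar>indicator S y * (H y - c)\<bar> \<le> (\<Prod>i\<in>I. b i) + \<bar>c\<bar>" for y
    using H_bounds[of y] by (auto simp: indicator_def abs_le_iff)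
  then show ?thesis
    by (intro P.integrable_const_bound[where B = "(\<Prod>i\<in>I. b i) + \<bar>c\<bar>"]) auto
qed

text \<open>\<open>PP\<close> has density \<open>H\<close> with respect to \<open>QQ\<close>, so the
  excess on an event becomes one integral over \<open>QQ\<close>.\<close>

lemma measure_diff_eq:
  assumes [measurable]: "S \<in> sets QQ"
  shows "measure PP S - c * measure QQ S = (\<integral>y. indicator S y * (H y - c) \<partial>QQ)"
proof -
  have h0: "0 \<le> h i y" for i y
    using bounds[of i] h_bounds[of i y] by linarith
  have i1: "integrable QQ (\<lambda>y. indicator S y * H y)"
    using integrable_H[OF assms, of 0] by simp
  have "PP = density QQ (\<lambda>y. ennreal (H y))"
    using prob_Q prob_density h0 by (subst PiM_density) (auto simp: prod_ennreal)
  then have "emeasure PP S = (\<integral>\<^sup>+y. ennreal (H y) * indicator S y \<partial>QQ)"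
    by (simp add: emeasure_density)
  also have "\<dots> = (\<integral>\<^sup>+y. ennreal (indicator S y * H y) \<partial>QQ)"
    by (intro nn_integral_cong) (auto simp: indicator_def)
  also have "\<dots> = ennreal (\<integral>y. indicator S y * H y \<partial>QQ)"
    using i1 H_bounds by (intro nn_integral_eq_integral) auto
  finally have "measure PP S = (\<integral>y. indicator S y * H y \<partial>QQ)"
    using H_bounds by (simp add: measure_def integral_nonneg)
  moreover have "(\<integral>y. indicator S y * (H y - c) \<partial>QQ)
      = (\<integral>y. indicator S y * H y \<partial>QQ) - (\<integral>y. c * indicator S y \<partial>QQ)"
    using i1 P.emeasure_finite[of S]
    by (subst Bochner_Integration.integral_diff[symmetric])
      (auto simp: algebra_simps less_top[symmetric] intro!: integrable_mult_right)
  ultimately show ?thesis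
    by simp
qed

text \<open>The integrand is at most the positive part of \<open>H y - c\<close>, which the chord
  bound dominates pointwise; integration then leaves the fixed weights.\<close>

lemma measure_diff_le:
  assumes S: "S \<in> sets QQ"
  shows "measure PP S - c * measure QQ S \<le> two_point_exp I weight a b (\<lambda>z. max 0 (z - c))"
proof -
  have "(\<integral>y. indicator S y * (H y - c) \<partial>QQ)
     \<le> (\<integral>y. two_point_exp I (\<lambda>i. (h i (y i) - a i) / (b i - a i)) a b (\<lambda>z. max 0 (z - c)) \<partial>QQ)"
  proof (intro integral_mono integrable_H[OF S] integrable_two_point_exp)
    fix y
    have "indicator S y * (H y - c) \<le> max 0 (H y - c)"
      by (auto simp: indicator_def)
    also have "\<dots> \<le> two_point_exp I (\<lambda>i. (h i (y i) - a i) / (b i - a i)) a b (\<lambda>z. max 0 (z - c))"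
      using convex_prod_le_two_point_exp[OF finite_I convex_on_pos_part] bounds h_bounds by simp
    finally show "indicator S y * (H y - c)
        \<le> two_point_exp I (\<lambda>i. (h i (y i) - a i) / (b i - a i)) a b (\<lambda>z. max 0 (z - c))" .
  qed
  then show ?thesis
    by (simp only: measure_diff_eq[OF S] integral_two_point_exp)
qed

lemma measure_diff_eq_two_point_exp:
  assumes "\<And>i y. h i y \<in> {a i, b i}"
  shows "\<exists>S\<in>sets QQ.
    measure PP S - c * measure QQ S = two_point_exp I weight a b (\<lambda>z. max 0 (z - c))"
proof (intro bexI)
  \<comment> \<open>The Neyman-Pearson event: it keeps exactly the outcomes at which the integrand
    is positive.\<close>
  let ?S = "{y \<in> space QQ. c < H y}"
  show S: "?S \<in> sets QQ"
    by measurable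
  have "(\<integral>y. indicator ?S y * (H y - c) \<partial>QQ)
     = (\<integral>y. two_point_exp I (\<lambda>i. (h i (y i) - a i) / (b i - a i)) a b (\<lambda>z. max 0 (z - c)) \<partial>QQ)"
  proof (rule Bochner_Integration.integral_cong)
    fix y assume "y \<in> space QQ"
    then have "indicator ?S y * (H y - c) = max 0 (H y - c)"
      by (auto simp: indicator_def)
    also have "\<dots> = two_point_exp I (\<lambda>i. (h i (y i) - a i) / (b i - a i)) a b (\<lambda>z. max 0 (z - c))"
      using bounds assms by (intro prod_eq_two_point_exp[where \<phi> = "\<lambda>z. max 0 (z - c)"]) auto
    finally show "indicator ?S y * (H y - c)
        = two_point_exp I (\<lambda>i. (h i (y i) - a i) / (b i - a i)) a b (\<lambda>z. max 0 (z - c))" .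
  qed simp
  then show "measure PP ?S - c * measure QQ ?S = two_point_exp I weight a b (\<lambda>z. max 0 (z - c))"
    by (simp only: measure_diff_eq[OF S] integral_two_point_exp)
qed

end

subsection \<open>Balancing the bounded-range parameters\<close>

text \<open>
  For a fixed product \<open>u1 * u2\<close> the expectation is affine in \<open>1 / u1 + 1 / u2\<close>, and convexity of \<open>\<phi>\<close>
  determines the sign of the slope.
\<close>

lemma convex_spread_le:
  fixes \<phi> :: "real \<Rightarrow> real"
  assumes "convex_on UNIV \<phi>" "E > 1"
    and "u1 * u2 = (v1 :: real) * v2" "u1 \<noteq> 0" "u2 \<noteq> 0" "v1 \<noteq> 0" "v2 \<noteq> 0"
    and "1 / v1 + 1 / v2 \<le> 1 / u1 + 1 / u2"
  defines "w \<equiv> \<lambda>u. (E / u - 1) / (E - 1)"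
  defines "G \<equiv> \<lambda>s t. w s * (w t * \<phi> (s * t) + (1 - w t) * \<phi> (s * t / E))
    + (1 - w s) * (w t * \<phi> (s * t / E) + (1 - w t) * \<phi> (s * t / E / E))"
  shows "G u1 u2 \<le> G v1 v2"
proof -
  \<comment> \<open>The weight \<open>w u\<close> gives the distribution on \<open>u\<close> and
    \<open>u / E\<close> mean 1. For a fixed product, \<open>K\<close> is minus the coefficient of
    \<open>1 / s + 1 / t\<close> in the expansion of \<open>(E - 1)\<^sup>2 * G s t\<close>.\<close>
  define K where "K = E * \<phi> (u1 * u2) - (E + E\<^sup>2) * \<phi> (u1 * u2 / E) + E\<^sup>2 * \<phi> (u1 * u2 / E / E)"
  have G: "(E - 1)\<^sup>2 * G s t = (E\<^sup>2 / (s * t) + 1) * \<phi> (s * t)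
      + (- 2 * E\<^sup>2 / (s * t) - 2 * E) * \<phi> (s * t / E) + (E\<^sup>2 / (s * t) + E\<^sup>2) * \<phi> (s * t / E / E)
      - (1 / s + 1 / t) * (E * \<phi> (s * t) - (E + E\<^sup>2) * \<phi> (s * t / E) + E\<^sup>2 * \<phi> (s * t / E / E))"
    if "s \<noteq> 0" "t \<noteq> 0" for s t
  proof -
    define x y where "x = 1 / s" and "y = 1 / t"
    have "w s * (E - 1) = E * x - 1" "w t * (E - 1) = E * y - 1"
      using assms(2) by (simp_all add: w_def x_def y_def)
    then have w: "w s * (E - 1) = E * x - 1" "w t * (E - 1) = E * y - 1"
      "(1 - w s) * (E - 1) = E - E * x" "(1 - w t) * (E - 1) = E - E * y"
      by (simp_all add: left_diff_distrib[of 1])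
    have "(E - 1)\<^sup>2 * G s t =
       (w s * (E - 1)) * ((w t * (E - 1)) * \<phi> (s * t) + ((1 - w t) * (E - 1)) * \<phi> (s * t / E))
     + ((1 - w s) * (E - 1)) * ((w t * (E - 1)) * \<phi> (s * t / E) + ((1 - w t) * (E - 1)) * \<phi> (s * t / E / E))"
      unfolding G_def by algebra
    also have "\<dots> = (E\<^sup>2 * (x * y) + 1) * \<phi> (s * t)
      + (- 2 * E\<^sup>2 * (x * y) - 2 * E) * \<phi> (s * t / E) + (E\<^sup>2 * (x * y) + E\<^sup>2) * \<phi> (s * t / E / E)
      - (x + y) * (E * \<phi> (s * t) - (E + E\<^sup>2) * \<phi> (s * t / E) + E\<^sup>2 * \<phi> (s * t / E / E))"
      unfolding w by algebra
    finally show ?thesis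
      by (simp add: x_def y_def)
  qed
  \<comment> \<open>Nonnegativity of \<open>K\<close> is the chord inequality for the middle point
    \<open>1 / E\<close> between \<open>1 / E / E\<close> and \<open>1\<close>; the chord weight
    \<open>l\<close> simplifies to \<open>1 / (1 + E)\<close>.\<close>
  define l where "l = (1 / E - 1 / E / E) / (1 - 1 / E / E)"
  have "\<phi> (1 / E * (u1 * u2)) \<le> l * \<phi> (1 * (u1 * u2)) + (1 - l) * \<phi> (1 / E / E * (u1 * u2))"
    unfolding l_def using assms(2) less_1_mult[OF assms(2,2)]
    by (intro convex_chord assms(1)) (auto simp: divide_simps)
  moreover have "l = 1 / (1 + E)"
  proof -
    have "1 - 1 / E / E = (1 / E - 1 / E / E) * (1 + E)" "1 / E - 1 / E / E \<noteq> 0"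
      using assms(2) by (auto simp: field_simps)
    then show ?thesis
      by (simp add: l_def)
  qed
  moreover have "1 - 1 / (1 + E) = E / (1 + E)"
    using assms(2) by (simp add: field_simps)
  ultimately have "\<phi> (u1 * u2 / E) \<le> 1 / (1 + E) * \<phi> (u1 * u2) + E / (1 + E) * \<phi> (u1 * u2 / E / E)"
    by simp
  then have "E * (1 + E) * \<phi> (u1 * u2 / E) \<le>
      E * (1 + E) * (1 / (1 + E) * \<phi> (u1 * u2) + E / (1 + E) * \<phi> (u1 * u2 / E / E))"
    using assms(2) by (intro mult_left_mono) auto
  also have "\<dots> = E * \<phi> (u1 * u2) + E\<^sup>2 * \<phi> (u1 * u2 / E / E)"
  proof -
    have "(1 + E) * (1 / (1 + E)) = 1" "E / (1 + E) = E * (1 / (1 + E))"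
      using assms(2) by simp_all
    then show ?thesis
      by algebra
  qed
  finally have "0 \<le> K"
    by (simp add: K_def power2_eq_square algebra_simps)
  then have "(1 / v1 + 1 / v2) * K \<le> (1 / u1 + 1 / u2) * K"
    using assms(8) by (intro mult_right_mono) auto
  then have "(E - 1)\<^sup>2 * G u1 u2 \<le> (E - 1)\<^sup>2 * G v1 v2"
    using G[OF assms(4,5)] G[OF assms(6,7)] unfolding K_def assms(3) by linarith
  then show ?thesis
    using assms(2) by simp
qed

text \<open>With \<open>x\<close>, \<open>y\<close>, \<open>z\<close> the exponentials of
  \<open>-s\<close>, \<open>-s'\<close>, \<open>-t'\<close>, the difference of the two sides is
  \<open>(x - y) * (x - z) / x\<close>, and both factors of the numerator are nonnegative since
  \<open>s\<close> is at most \<open>s'\<close> and \<open>t'\<close>.\<close>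

lemma exp_spread_le:
  fixes s t s' t' :: real
  assumes "s + t = s' + t'" "s \<le> s'" "s \<le> t'"
  shows "1 / exp s' + 1 / exp t' \<le> 1 / exp s + 1 / exp t"
proof -
  define x y z where "x = exp (- s)" and "y = exp (- s')" and "z = exp (- t')"
  have t: "exp (- t) = y * z / x"
    using assms(1) by (simp add: x_def y_def z_def flip: exp_add exp_diff)
  have pos: "x > 0" "y \<le> x" "z \<le> x"
    using assms by (auto simp: x_def y_def z_def)
  have "0 \<le> (x - y) * (x - z) / x"
    using pos by simp
  also have "\<dots> = x + y * z / x - (y + z)"
    using pos by (simp add: field_simps)
  finally have "y + z \<le> x + exp (- t)"
    using t by simp
  then show ?thesis
    by (simp add: exp_minus inverse_eq_divide x_def y_def z_def)
qed

text \<open>Randomized response with privacy losses \<open>t i\<close> and \<open>t i - r i\<close>.\<close>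

definition rr_exp :: "'i set \<Rightarrow> ('i \<Rightarrow> real) \<Rightarrow> ('i \<Rightarrow> real) \<Rightarrow> (real \<Rightarrow> real) \<Rightarrow> real" where
  "rr_exp I r t \<phi> =
     two_point_exp I (\<lambda>i. (1 - exp (t i - r i)) / (exp (t i) - exp (t i - r i)))
       (\<lambda>i. exp (t i - r i)) (\<lambda>i. exp (t i)) \<phi>"

lemma rr_exp_cong:
  assumes "\<And>i. i \<in> I \<Longrightarrow> r i = r' i \<and> t i = t' i"
  shows "rr_exp I r t \<phi> = rr_exp I r' t' \<phi>"
  unfolding rr_exp_def using assms by (intro two_point_exp_cong) auto

text \<open>The weight is rewritten as \<open>(E / u - 1) / (E - 1)\<close> with
  \<open>E = exp (r i)\<close> and \<open>u = exp (t i)\<close>, the form used in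
  \<open>convex_spread_le\<close>.\<close>

lemma rr_exp_insert:
  assumes "finite I" "i \<notin> I"
  shows "rr_exp (insert i I) r t \<phi> =
    (exp (r i) / exp (t i) - 1) / (exp (r i) - 1) * rr_exp I r t (\<lambda>z. \<phi> (exp (t i) * z))
    + (1 - (exp (r i) / exp (t i) - 1) / (exp (r i) - 1)) * rr_exp I r t (\<lambda>z. \<phi> (exp (t i) / exp (r i) * z))"
proof -
  have "1 - exp (t i - r i) = exp (t i - r i) * (exp (r i) / exp (t i) - 1)"
    "exp (t i) - exp (t i - r i) = exp (t i - r i) * (exp (r i) - 1)"
    by (simp_all add: exp_diff field_simps)
  then have "(1 - exp (t i - r i)) / (exp (t i) - exp (t i - r i)) = (exp (r i) / exp (t i) - 1) / (exp (r i) - 1)"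
    by (simp only: mult_divide_mult_cancel_left exp_not_eq_zero not_False_eq_True)
  then show ?thesis
    using assms by (simp add: rr_exp_def two_point_exp_insert exp_diff)
qed

lemma rr_exp_mono:
  assumes "\<And>i. i \<in> I \<Longrightarrow> 0 \<le> t i \<and> t i \<le> r i" "\<And>z. \<phi> z \<le> \<psi> z"
  shows "rr_exp I r t \<phi> \<le> rr_exp I r t \<psi>"
  unfolding rr_exp_def
proof (rule two_point_exp_mono)
  fix i assume "i \<in> I"
  with assms(1) have "0 \<le> t i" "t i \<le> r i"
    by auto
  then show "0 \<le> (1 - exp (t i - r i)) / (exp (t i) - exp (t i - r i))
      \<and> (1 - exp (t i - r i)) / (exp (t i) - exp (t i - r i)) \<le> 1"
    \<comment> \<open>For \<open>r i = 0\<close> the denominator vanishes, and the weight is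
      \<open>0\<close> by the convention for division by zero.\<close>
    by (cases "r i = 0") (auto simp: divide_simps)
qed fact

lemma rr_exp_add: "rr_exp I r t (\<lambda>z. \<phi> z + \<psi> z) = rr_exp I r t \<phi> + rr_exp I r t \<psi>"
  unfolding rr_exp_def by (rule two_point_exp_add)

lemma rr_exp_scale: "rr_exp I r t (\<lambda>z. c * \<phi> z) = c * rr_exp I r t \<phi>"
  unfolding rr_exp_def by (rule two_point_exp_scale)

text \<open>Conditioning on \<open>i\<close> and \<open>j\<close> leaves an expectation over the
  remaining product \<open>z\<close>. For each \<open>z\<close> the inner expression increases by
  \<open>convex_spread_le\<close>, applied to \<open>\<phi>\<close> rescaled by \<open>z\<close>;
  monotonicity of the outer expectation finishes.\<close>

lemma rr_exp_balance:
  assumes "finite I" "i \<in> I" "j \<in> I" "i \<noteq> j" "convex_on UNIV \<phi>"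
    and r: "r i = r j" "0 < r i" and t: "\<And>l. l \<in> I \<Longrightarrow> 0 \<le> t l \<and> t l \<le> r l"
    and "t i + t j = t' i + t' j" "t i \<le> t' i" "t i \<le> t' j"
    and t': "\<And>l. l \<in> I - {i, j} \<Longrightarrow> t' l = t l"
  shows "rr_exp I r t \<phi> \<le> rr_exp I r t' \<phi>"
proof -
  define K where "K = I - {i, j}"
  have K: "finite K" "i \<notin> insert j K" "j \<notin> K" and I: "I = insert i (insert j K)"
    using assms(1-4) by (auto simp: K_def)
  define E where "E = exp (r i)"
  have E: "exp (r i) = E" "exp (r j) = E" "1 < E"
    using r by (auto simp: E_def)
  define w where "w u = (E / u - 1) / (E - 1)" for u
  define G where "G z s t = w s * (w t * \<phi> (s * t * z) + (1 - w t) * \<phi> (s * t / E * z))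
    + (1 - w s) * (w t * \<phi> (s * t / E * z) + (1 - w t) * \<phi> (s * t / E / E * z))" for z s t
  have expand: "rr_exp I r T \<phi> = rr_exp K r T (\<lambda>z. G z (exp (T i)) (exp (T j)))" for T
    using K unfolding I G_def
    by (simp add: rr_exp_insert E rr_exp_add rr_exp_scale flip: w_def)
      (simp add: mult_ac)
  have "rr_exp I r t \<phi> = rr_exp K r t (\<lambda>z. G z (exp (t i)) (exp (t j)))"
    by (rule expand)
  also have "\<dots> \<le> rr_exp K r t (\<lambda>z. G z (exp (t' i)) (exp (t' j)))"
  proof (rule rr_exp_mono)
    show "0 \<le> t l \<and> t l \<le> r l" if "l \<in> K" for l
      using that t by (auto simp: K_def)
    show "G z (exp (t i)) (exp (t j)) \<le> G z (exp (t' i)) (exp (t' j))" for z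
      unfolding G_def w_def
    proof (rule convex_spread_le[where \<phi> = "\<lambda>y. \<phi> (y * z)"])
      show "convex_on UNIV (\<lambda>y. \<phi> (y * z))"
        using convex_on_scale[OF assms(5), of z] by (simp add: mult.commute)
      show "1 / exp (t' i) + 1 / exp (t' j) \<le> 1 / exp (t i) + 1 / exp (t j)"
        by (rule exp_spread_le[OF assms(9-11)])
      show "exp (t i) * exp (t j) = exp (t' i) * exp (t' j)"
        by (simp only: assms(9) flip: exp_add)
    qed (use E(3) in simp_all)
  qed
  also have "\<dots> = rr_exp K r t' (\<lambda>z. G z (exp (t' i)) (exp (t' j)))"
    using t' by (intro rr_exp_cong) (auto simp: K_def)
  also have "\<dots> = rr_exp I r t' \<phi>"
    by (rule expand[symmetric])
  finally show ?thesis .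
qed

text \<open>Induction on the number of indices in \<open>B\<close> not yet at the mean
  \<open>\<mu>\<close>. As long as there is one, some parameter lies below and another above
  \<open>\<mu>\<close>, and balancing this pair settles at least one of them.\<close>

lemma rr_exp_equalize_aux:
  assumes "finite I" "B \<subseteq> I" "convex_on UNIV \<phi>" "0 < \<rho>" "\<And>i. i \<in> B \<Longrightarrow> r i = \<rho>"
    and "\<And>i. i \<in> I \<Longrightarrow> 0 \<le> t i \<and> t i \<le> r i" "(\<Sum>i\<in>B. t i) = real (card B) * \<mu>"
  shows "rr_exp I r t \<phi> \<le> rr_exp I r (\<lambda>i. if i \<in> B then \<mu> else t i) \<phi>"
  using assms(6,7)
proof (induction "card {i \<in> B. t i \<noteq> \<mu>}" arbitrary: t rule: less_induct)
  case less
  have fB: "finite B"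
    using assms(1,2) finite_subset by blast
  show ?case
  proof (cases "\<forall>i\<in>B. t i = \<mu>")
    case True
    then show ?thesis
      by (intro eq_refl rr_exp_cong) auto
  next
    case False
    then obtain l where l: "l \<in> B" "t l \<noteq> \<mu>"
      by blast
    have sum\<mu>: "(\<Sum>i\<in>B. t i) = (\<Sum>i\<in>B. \<mu>)"
      using less.prems(2) by simp
    have "\<exists>i\<in>B. t i < \<mu>"
    proof (rule ccontr)
      assume "\<not> ?thesis"
      then have "(\<Sum>i\<in>B. \<mu>) < (\<Sum>i\<in>B. t i)"
        using l fB by (intro sum_strict_mono_ex1) (auto intro!: bexI[of _ l] simp: not_less less_le)
      then show False
        using sum\<mu> by simp
    qed
    then obtain i where i: "i \<in> B" "t i < \<mu>" ..
    have "\<exists>j\<in>B. \<mu> < t j"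
    proof (rule ccontr)
      assume "\<not> ?thesis"
      then have "(\<Sum>i\<in>B. t i) < (\<Sum>i\<in>B. \<mu>)"
        using l fB by (intro sum_strict_mono_ex1) (auto intro!: bexI[of _ l] simp: not_less less_le)
      then show False
        using sum\<mu> by simp
    qed
    then obtain j where j: "j \<in> B" "\<mu> < t j" ..
    have ij: "i \<noteq> j" "i \<in> I" "j \<in> I"
      using i j assms(2) by auto
    \<comment> \<open>The lower parameter moves up to \<open>\<mu>\<close> and the upper one down by
      the same amount. Both new values stay between \<open>t i\<close> and \<open>t j\<close>, so
      the bounds survive and \<open>rr_exp_balance\<close> applies.\<close>
    define t' where "t' = t(i := \<mu>, j := t i + t j - \<mu>)"
    have t': "t' i = \<mu>" "t' j = t i + t j - \<mu>" "\<And>l. l \<noteq> i \<Longrightarrow> l \<noteq> j \<Longrightarrow> t' l = t l"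
      using ij by (auto simp: t'_def)
    have "{l \<in> B. t' l \<noteq> \<mu>} \<subset> {l \<in> B. t l \<noteq> \<mu>}"
    proof
      show "{l \<in> B. t' l \<noteq> \<mu>} \<subseteq> {l \<in> B. t l \<noteq> \<mu>}"
      proof
        fix l assume "l \<in> {l \<in> B. t' l \<noteq> \<mu>}"
        then show "l \<in> {l \<in> B. t l \<noteq> \<mu>}"
          using j t' by (cases "l = j"; cases "l = i") auto
      qed
      have "i \<in> {l \<in> B. t l \<noteq> \<mu>}" "i \<notin> {l \<in> B. t' l \<noteq> \<mu>}"
        using i t'(1) by simp_all
      then show "{l \<in> B. t' l \<noteq> \<mu>} \<noteq> {l \<in> B. t l \<noteq> \<mu>}"
        by metis
    qed
    then have card: "card {l \<in> B. t' l \<noteq> \<mu>} < card {l \<in> B. t l \<noteq> \<mu>}"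
      using fB by (intro psubset_card_mono) auto
    have r: "r i = \<rho>" "r j = \<rho>"
      using i j assms(5) by auto
    have bounds': "0 \<le> t' l \<and> t' l \<le> r l" if "l \<in> I" for l
      using that less.prems(1)[of l] less.prems(1)[OF ij(2)] less.prems(1)[OF ij(3)] i j r t'
      by (cases "l = i"; cases "l = j") auto
    have "(\<Sum>l\<in>B. t' l) = t' i + t' j + (\<Sum>l\<in>B - {i} - {j}. t' l)"
      using i j ij fB by (simp add: sum.remove[of B i] sum.remove[of "B - {i}" j])
    also have "\<dots> = t i + t j + (\<Sum>l\<in>B - {i} - {j}. t l)"
    proof -
      have "(\<Sum>l\<in>B - {i} - {j}. t' l) = (\<Sum>l\<in>B - {i} - {j}. t l)"
        using t'(3) by (intro sum.cong) auto
      then show ?thesis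
        using t'(1,2) by simp
    qed
    also have "\<dots> = (\<Sum>l\<in>B. t l)"
      using i j ij fB by (simp add: sum.remove[of B i] sum.remove[of "B - {i}" j])
    finally have sum': "(\<Sum>l\<in>B. t' l) = real (card B) * \<mu>"
      using less.prems(2) by simp
    have "rr_exp I r t \<phi> \<le> rr_exp I r t' \<phi>"
      using t' i j r assms(4) less.prems(1)
      by (intro rr_exp_balance[OF assms(1) ij(2,3,1) assms(3)]) auto
    also have "\<dots> \<le> rr_exp I r (\<lambda>i. if i \<in> B then \<mu> else t' i) \<phi>"
      using card bounds' sum' by (rule less.hyps)
    also have "\<dots> = rr_exp I r (\<lambda>i. if i \<in> B then \<mu> else t i) \<phi>"
    proof (rule rr_exp_cong)
      fix l
      have "l \<notin> B \<Longrightarrow> t' l = t l"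
        using i j t'(3)[of l] by auto
      then show "r l = r l \<and> (if l \<in> B then \<mu> else t' l) = (if l \<in> B then \<mu> else t l)"
        by simp
    qed
    finally show ?thesis .
  qed
qed

lemma rr_exp_equalize:
  assumes "finite I" "B \<subseteq> I" "convex_on UNIV \<phi>" "0 < \<rho>" "\<And>i. i \<in> B \<Longrightarrow> r i = \<rho>"
    and t: "\<And>i. i \<in> I \<Longrightarrow> 0 \<le> t i \<and> t i \<le> r i"
  obtains \<mu> where "0 \<le> \<mu>" "\<mu> \<le> \<rho>"
    "rr_exp I r t \<phi> \<le> rr_exp I r (\<lambda>i. if i \<in> B then \<mu> else t i) \<phi>"
proof (cases "B = {}")
  case True
  then show thesis
    using assms(4) by (intro that[of 0]) auto
next
  case False
  have fB: "finite B"
    using assms(1,2) finite_subset by blast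
  then have pos: "0 < real (card B)"
    using False by (simp add: card_gt_0_iff)
  have "0 \<le> (\<Sum>i\<in>B. t i)" "(\<Sum>i\<in>B. t i) \<le> real (card B) * \<rho>"
    using t assms(2,5) sum_bounded_above[of B t \<rho>] by (fastforce intro!: sum_nonneg)+
  then show thesis
    using pos rr_exp_equalize_aux[OF assms, where \<mu> = "(\<Sum>i\<in>B. t i) / real (card B)"]
    by (intro that[of "(\<Sum>i\<in>B. t i) / real (card B)"]) (auto simp: divide_simps mult.commute)
qed

text \<open>A change of measure: the two-point weight is the probability of the high outcome under
  the reference input, and multiplying by the likelihood ratio \<open>exp t\<close> gives its
  probability \<open>q r t\<close> under the other input. The second equation does the same for the
  low outcome.\<close>

lemma q_eq_two_point_weight:
  assumes "0 < r"
  shows "q r t = exp t * ((1 - exp (t - r)) / (exp t - exp (t - r)))"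
    and "1 - q r t = exp (t - r) * (1 - (1 - exp (t - r)) / (exp t - exp (t - r)))"
proof -
  have 1: "exp t - exp (t - r) = exp t * (1 - exp (- r))"
    by (simp add: algebra_simps flip: exp_add)
  have 2: "1 - exp (- r) \<noteq> 0" "exp t \<noteq> exp (t - r)"
    using assms by simp_all
  show "q r t = exp t * ((1 - exp (t - r)) / (exp t - exp (t - r)))"
    unfolding q_def 1 using 2 by simp
  have "1 - q r t = (exp (t - r) - exp (- r)) / (1 - exp (- r))"
    using 2 by (simp add: q_def field_simps)
  also have "\<dots> = exp (t - r) * ((exp t - 1) / (exp t - exp (t - r)))"
    unfolding 1 using 2 by (simp add: field_simps flip: exp_add)
  also have "(exp t - 1) / (exp t - exp (t - r)) = 1 - (1 - exp (t - r)) / (exp t - exp (t - r))"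
    using 2(2) by (simp add: field_simps)
  finally show "1 - q r t = exp (t - r) * (1 - (1 - exp (t - r)) / (exp t - exp (t - r)))" .
qed

text \<open>The coordinates are split into \<open>B\<close> and its complement, and each block is
  expanded binomially. Pulling the likelihood ratio \<open>V\<close> out of the positive part and
  distributing its factors over the weights turns them into powers of \<open>q\<close> and
  \<open>1 - q\<close>.\<close>

lemma rr_exp_eq_comp_delta:
  assumes "finite I" "B \<subseteq> I" "card B = k - m" "card (I - B) = m" "m \<le> k" "0 < \<epsilon>"
  shows "rr_exp I (\<lambda>i. if i \<in> B then \<epsilon> else 2 * \<epsilon>) (\<lambda>i. if i \<in> B then \<tau> else \<epsilon>) (\<lambda>z. max 0 (z - exp \<epsilon>g))
    = comp_delta k m \<epsilon> \<epsilon>g \<tau>"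
proof -
  define w where "w r t = (1 - exp (t - r)) / (exp t - exp (t - r))" for r t :: real
  have fB: "finite B" "finite (I - B)"
    using assms(1,2) finite_subset by auto
  have q: "q \<epsilon> \<tau> = exp \<tau> * w \<epsilon> \<tau>" "1 - q \<epsilon> \<tau> = exp (\<tau> - \<epsilon>) * (1 - w \<epsilon> \<tau>)"
    "q (2 * \<epsilon>) \<epsilon> = exp \<epsilon> * w (2 * \<epsilon>) \<epsilon>" "1 - q (2 * \<epsilon>) \<epsilon> = exp (\<epsilon> - 2 * \<epsilon>) * (1 - w (2 * \<epsilon>) \<epsilon>)"
    using q_eq_two_point_weight[of \<epsilon> \<tau>] q_eq_two_point_weight[of "2 * \<epsilon>" \<epsilon>] assms(6) by (simp_all add: w_def)
  let ?w = "\<lambda>i. if i \<in> B then w \<epsilon> \<tau> else w (2 * \<epsilon>) \<epsilon>"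
  let ?a = "\<lambda>i. if i \<in> B then exp (\<tau> - \<epsilon>) else exp (\<epsilon> - 2 * \<epsilon>)"
  let ?b = "\<lambda>i. if i \<in> B then exp \<tau> else exp \<epsilon>"
  have 1: "two_point_exp B ?w ?a ?b \<phi> = two_point_exp B (\<lambda>_. w \<epsilon> \<tau>) (\<lambda>_. exp (\<tau> - \<epsilon>)) (\<lambda>_. exp \<tau>) \<phi>" for \<phi>
    by (rule two_point_exp_cong) auto
  have 2: "two_point_exp (I - B) ?w ?a ?b \<phi>
      = two_point_exp (I - B) (\<lambda>_. w (2 * \<epsilon>) \<epsilon>) (\<lambda>_. exp (\<epsilon> - 2 * \<epsilon>)) (\<lambda>_. exp \<epsilon>) \<phi>" for \<phi>
    by (rule two_point_exp_cong) auto
  have "rr_exp I (\<lambda>i. if i \<in> B then \<epsilon> else 2 * \<epsilon>) (\<lambda>i. if i \<in> B then \<tau> else \<epsilon>) (\<lambda>z. max 0 (z - exp \<epsilon>g))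
      = two_point_exp I ?w ?a ?b (\<lambda>z. max 0 (z - exp \<epsilon>g))"
    unfolding rr_exp_def by (rule two_point_exp_cong) (auto simp: w_def)
  also have "\<dots> = two_point_exp (B \<union> (I - B)) ?w ?a ?b (\<lambda>z. max 0 (z - exp \<epsilon>g))"
    using assms(2) by (simp add: Un_absorb1)
  also have "\<dots> = (\<Sum>i\<le>k - m. real ((k - m) choose i) * w \<epsilon> \<tau> ^ (k - m - i) * (1 - w \<epsilon> \<tau>) ^ i *
        (\<Sum>j\<le>m. real (m choose j) * w (2 * \<epsilon>) \<epsilon> ^ (m - j) * (1 - w (2 * \<epsilon>) \<epsilon>) ^ j *
          max 0 (exp \<tau> ^ (k - m - i) * exp (\<tau> - \<epsilon>) ^ i * (exp \<epsilon> ^ (m - j) * exp (\<epsilon> - 2 * \<epsilon>) ^ j) - exp \<epsilon>g)))"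
    using fB assms(3,4) by (subst two_point_exp_union) (auto simp: 1 2 two_point_exp_const)
  also have "\<dots> = comp_delta k m \<epsilon> \<epsilon>g \<tau>"
    unfolding comp_delta_def sum_distrib_left atMost_atLeast0
  proof (intro sum.cong refl)
    fix i j assume "i \<in> {0..k - m}" "j \<in> {0..m}"
    then have ij: "real (k - m - i) = real k - real m - real i" "real (m - j) = real m - real j"
      using assms(5) by auto
    \<comment> \<open>The total likelihood ratio when \<open>i\<close> bounded-range and
      \<open>j\<close> pure DP coordinates take their lower value.\<close>
    define V where "V = exp \<tau> ^ (k - m - i) * exp (\<tau> - \<epsilon>) ^ i * (exp \<epsilon> ^ (m - j) * exp (\<epsilon> - 2 * \<epsilon>) ^ j)"
    have V: "V = exp (\<epsilon> * (real m - 2 * real j - real i) + \<tau> * (real k - real m))"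
      unfolding V_def exp_of_nat_mult[symmetric] exp_add[symmetric] ij by (simp add: algebra_simps)
    then have "V * (1 - exp (\<epsilon>g - \<epsilon> * (real m - 2 * real j - real i) - \<tau> * (real k - real m))) = V - exp \<epsilon>g"
      by (simp add: right_diff_distrib flip: exp_add)
    moreover have "max 0 (V * x) = V * max 0 x" for x
      using V by (simp add: max_def zero_le_mult_iff)
    ultimately have X: "max 0 (V - exp \<epsilon>g)
        = V * max 0 (1 - exp (\<epsilon>g - \<epsilon> * (real m - 2 * real j - real i) - \<tau> * (real k - real m)))"
      by metis
    show "real (k - m choose i) * w \<epsilon> \<tau> ^ (k - m - i) * (1 - w \<epsilon> \<tau>) ^ i *
        (real (m choose j) * w (2 * \<epsilon>) \<epsilon> ^ (m - j) * (1 - w (2 * \<epsilon>) \<epsilon>) ^ j *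
         max 0 (exp \<tau> ^ (k - m - i) * exp (\<tau> - \<epsilon>) ^ i * (exp \<epsilon> ^ (m - j) * exp (\<epsilon> - 2 * \<epsilon>) ^ j) - exp \<epsilon>g)) =
       real (k - m choose i) * real (m choose j) * q (2 * \<epsilon>) \<epsilon> ^ (m - j) * (1 - q (2 * \<epsilon>) \<epsilon>) ^ j *
         q \<epsilon> \<tau> ^ (k - m - i) * (1 - q \<epsilon> \<tau>) ^ i *
        max 0 (1 - exp (\<epsilon>g - \<epsilon> * (real m - 2 * real j - real i) - \<tau> * (real k - real m)))"
      unfolding V_def[symmetric] X unfolding q(2,4) unfolding q(1,3) V_def power_mult_distrib
      by (simp only: mult_ac)
  qed
  finally show ?thesis .
qed

subsection \<open>Maximizing over the common parameter\<close>

definition binomial_cdf :: "nat \<Rightarrow> nat \<Rightarrow> real \<Rightarrow> real" where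
  "binomial_cdf n a p = (\<Sum>i\<le>a. real (n choose i) * p ^ i * (1 - p) ^ (n - i))"

lemma binomial_cdf_0 [simp]: "binomial_cdf 0 a p = 1"
  by (induction a) (simp_all add: binomial_cdf_def)

text \<open>Each summand has as derivative \<open>Suc n\<close> times a difference of neighboring
  point masses of the binomial distribution with \<open>n\<close> trials, so the sum telescopes to
  its last term.\<close>

lemma binomial_cdf_deriv:
  fixes p :: real
  shows "(binomial_cdf (Suc n) a has_real_derivative
    - real (Suc n) * real (n choose a) * p ^ a * (1 - p) ^ (n - a)) (at p)"
  unfolding binomial_cdf_def
proof (induction a)
  case 0
  have "((\<lambda>p. 1 - p) has_real_derivative -1) (at p)"
    by (auto intro!: derivative_eq_intros)
  from DERIV_power_Suc[OF this, of n] show ?case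
    by (simp add: algebra_simps)
next
  case (Suc a)
  have D: "((\<lambda>p. real (Suc n choose Suc a) * p ^ Suc a * (1 - p) ^ (Suc n - Suc a)) has_real_derivative
     real (Suc n choose Suc a) * (real (Suc a) * p ^ a * (1 - p) ^ (n - a)
       - p ^ Suc a * (real (n - a) * (1 - p) ^ (n - a - 1)))) (at p)"
  proof -
    have "((\<lambda>p. 1 - p) has_real_derivative -1) (at p)"
      by (auto intro!: derivative_eq_intros)
    from DERIV_cmult[OF DERIV_mult[OF DERIV_power_Suc[OF DERIV_ident] DERIV_power[OF this]]]
    show ?thesis
      unfolding mult.assoc by (rule DERIV_cong) (simp add: algebra_simps)
  qed
  have 1: "real (Suc n choose Suc a) * real (Suc a) = real (Suc n) * real (n choose a)"
    by (metis Suc_times_binomial_eq of_nat_mult)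
  have 2: "real (Suc n choose Suc a) * real (n - a) = real (Suc n) * real (n choose Suc a)"
  \<comment> \<open>For \<open>n \<le> a\<close> the truncated difference \<open>n - a\<close> and
    the binomial coefficient on the right are both \<open>0\<close>.\<close>
  proof (cases "a < n")
    case True
    have "(n - a) * (Suc n choose Suc a) = Suc n * (n choose Suc a)"
      using binomial_absorb_comp[of "Suc n" "Suc a"] by simp
    then show ?thesis
      by (metis of_nat_mult mult.commute)
  qed simp
  have "real (Suc n choose Suc a) * (real (Suc a) * p ^ a * (1 - p) ^ (n - a)
       - p ^ Suc a * (real (n - a) * (1 - p) ^ (n - a - 1)))
     = (real (Suc n choose Suc a) * real (Suc a)) * p ^ a * (1 - p) ^ (n - a)
       - (real (Suc n choose Suc a) * real (n - a)) * p ^ Suc a * (1 - p) ^ (n - Suc a)"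
    by (simp add: algebra_simps)
  also have "\<dots> = real (Suc n) * real (n choose a) * p ^ a * (1 - p) ^ (n - a)
       - real (Suc n) * real (n choose Suc a) * p ^ Suc a * (1 - p) ^ (n - Suc a)"
    by (simp only: 1 2)
  finally show ?case
    using DERIV_add[OF Suc D] unfolding sum.atMost_Suc by (elim DERIV_cong) linarith
qed

text \<open>
  The sum defining \<^const>\<open>comp_delta\<close> without the positive part, restricted to \<open>2 * j + i \<le> l\<close>; the
  inner sum over \<open>i\<close> is expressed by distribution functions because these have a one-term derivative.
\<close>

definition trunc_delta :: "nat \<Rightarrow> nat \<Rightarrow> real \<Rightarrow> real \<Rightarrow> nat \<Rightarrow> real \<Rightarrow> real" where
  "trunc_delta k m \<epsilon> \<epsilon>g l t =
     (\<Sum>j\<in>{j. j \<le> m \<and> 2 * j \<le> l}.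
        real (m choose j) * q (2 * \<epsilon>) \<epsilon> ^ (m - j) * (1 - q (2 * \<epsilon>) \<epsilon>) ^ j *
        (binomial_cdf (k - m) (l - 2 * j) (1 - q \<epsilon> t)
          - exp (\<epsilon>g - \<epsilon> * (real m - 2 * real j))
            * binomial_cdf (k - m) (l - 2 * j) (exp (\<epsilon> - t) * (1 - q \<epsilon> t))))"

section \<open>Truncated sums compared with the full sum\<close>

lemma q_bounds:
  assumes "0 < r" "0 \<le> t" "t \<le> r"
  shows "0 \<le> q r t" "q r t \<le> 1"
  using assms by (auto simp: q_def divide_simps)

text \<open>The second distribution function in \<open>trunc_delta\<close> is taken at the
  low-outcome probability under the reference input. Its powers of
  \<open>exp (\<epsilon> - t)\<close> and \<open>exp (- t)\<close> combine with the prefactor to the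
  exponential subtracted in \<open>comp_delta\<close>.\<close>

lemma trunc_delta_eq:
  assumes "m \<le> k" "0 < \<epsilon>"
  shows "trunc_delta k m \<epsilon> \<epsilon>g l t = (\<Sum>i=0..k - m. \<Sum>j=0..m. if 2 * j + i \<le> l then
        real ((k - m) choose i) * real (m choose j) *
        q (2 * \<epsilon>) \<epsilon> ^ (m - j) * (1 - q (2 * \<epsilon>) \<epsilon>) ^ j *
        q \<epsilon> t ^ (k - m - i) * (1 - q \<epsilon> t) ^ i *
        (1 - exp (\<epsilon>g - \<epsilon> * (real m - 2 * real j - real i) - t * (real k - real m))) else 0)"
proof -
  define n where "n = k - m"
  have n: "real k - real m = real n"
    using assms(1) by (simp add: n_def)
  define p where "p = 1 - q \<epsilon> t"
  \<comment> \<open>Both sides are the probability of the high outcome under the reference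
    input.\<close>
  have p': "1 - exp (\<epsilon> - t) * p = exp (- t) * q \<epsilon> t"
  proof -
    have ne: "1 - exp (- \<epsilon>) \<noteq> 0"
      using assms(2) by simp
    have "1 - exp (\<epsilon> - t) + exp (\<epsilon> - t) * q \<epsilon> t - exp (- t) * q \<epsilon> t
        = 1 - exp (\<epsilon> - t) + exp (\<epsilon> - t) * ((1 - exp (- \<epsilon>)) * q \<epsilon> t)"
      by (simp add: algebra_simps flip: exp_add)
    also have "(1 - exp (- \<epsilon>)) * q \<epsilon> t = 1 - exp (t - \<epsilon>)"
      using ne by (simp add: q_def)
    also have "1 - exp (\<epsilon> - t) + exp (\<epsilon> - t) * (1 - exp (t - \<epsilon>)) = 0"
      by (simp add: algebra_simps flip: exp_add)
    finally show ?thesis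
      by (simp add: p_def algebra_simps)
  qed
  have cdf: "binomial_cdf n (l - 2 * j) u
      = (\<Sum>i=0..n. if 2 * j + i \<le> l then real (n choose i) * u ^ i * (1 - u) ^ (n - i) else 0)"
    if "2 * j \<le> l" for j u
  proof -
    \<comment> \<open>The indices dropped here exceed \<open>n\<close>, where the binomial
      coefficient is \<open>0\<close>.\<close>
    have "binomial_cdf n (l - 2 * j) u = (\<Sum>i\<in>{i\<in>{0..n}. 2 * j + i \<le> l}. real (n choose i) * u ^ i * (1 - u) ^ (n - i))"
      unfolding binomial_cdf_def using that by (intro sum.mono_neutral_right) auto
    then show ?thesis
      unfolding sum.inter_filter[OF finite_atLeastAtMost] .
  qed
  have e: "exp (\<epsilon>g - \<epsilon> * (real m - 2 * real j)) * ((exp (\<epsilon> - t) * p) ^ i * (exp (- t) * q \<epsilon> t) ^ (n - i))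
     = exp (\<epsilon>g - \<epsilon> * (real m - 2 * real j - real i) - t * real n) * (p ^ i * q \<epsilon> t ^ (n - i))"
    if "i \<le> n" for i j
  proof -
    have "exp (\<epsilon>g - \<epsilon> * (real m - 2 * real j)) * (exp (\<epsilon> - t) ^ i * exp (- t) ^ (n - i))
       = exp (\<epsilon>g - \<epsilon> * (real m - 2 * real j - real i) - t * real n)"
      unfolding exp_of_nat_mult[symmetric] exp_add[symmetric] of_nat_diff[OF that]
      by (simp add: algebra_simps)
    then show ?thesis
      by (simp add: power_mult_distrib mult_ac)
  qed
  have "trunc_delta k m \<epsilon> \<epsilon>g l t = (\<Sum>j=0..m. if 2 * j \<le> l then
        real (m choose j) * q (2 * \<epsilon>) \<epsilon> ^ (m - j) * (1 - q (2 * \<epsilon>) \<epsilon>) ^ j *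
        (binomial_cdf n (l - 2 * j) p
          - exp (\<epsilon>g - \<epsilon> * (real m - 2 * real j)) * binomial_cdf n (l - 2 * j) (exp (\<epsilon> - t) * p)) else 0)"
    unfolding trunc_delta_def n_def[symmetric] p_def[symmetric]
    by (simp add: sum.inter_filter[symmetric])
  also have "\<dots> = (\<Sum>j=0..m. \<Sum>i=0..n. if 2 * j + i \<le> l then
        real (n choose i) * real (m choose j) *
        q (2 * \<epsilon>) \<epsilon> ^ (m - j) * (1 - q (2 * \<epsilon>) \<epsilon>) ^ j *
        q \<epsilon> t ^ (n - i) * p ^ i *
        (1 - exp (\<epsilon>g - \<epsilon> * (real m - 2 * real j - real i) - t * real n)) else 0)"
  proof (intro sum.cong refl)
    fix j
    define W where "W = real (m choose j) * q (2 * \<epsilon>) \<epsilon> ^ (m - j) * (1 - q (2 * \<epsilon>) \<epsilon>) ^ j"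
    define C where "C = exp (\<epsilon>g - \<epsilon> * (real m - 2 * real j))"
    have "(if 2 * j \<le> l then W * (binomial_cdf n (l - 2 * j) p - C * binomial_cdf n (l - 2 * j) (exp (\<epsilon> - t) * p)) else 0)
      = (\<Sum>i=0..n. if 2 * j + i \<le> l then W * (real (n choose i) * (p ^ i * q \<epsilon> t ^ (n - i))
          - C * (real (n choose i) * ((exp (\<epsilon> - t) * p) ^ i * (exp (- t) * q \<epsilon> t) ^ (n - i)))) else 0)"
    proof (cases "2 * j \<le> l")
      case True
      have q: "q \<epsilon> t = 1 - p"
        by (simp add: p_def)
      show ?thesis
        unfolding cdf[OF True] p' q using True
        by (simp add: sum_distrib_left flip: sum_subtractf) (auto intro!: sum.cong simp: mult_ac)
    qed (auto intro!: sum.neutral)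
    also have "\<dots> = (\<Sum>i=0..n. if 2 * j + i \<le> l then
        real (n choose i) * W * q \<epsilon> t ^ (n - i) * p ^ i *
        (1 - exp (\<epsilon>g - \<epsilon> * (real m - 2 * real j - real i) - t * real n)) else 0)"
    proof (intro sum.cong refl if_cong)
      fix i assume "i \<in> {0..n}"
      then have *: "C * ((exp (\<epsilon> - t) * p) ^ i * (exp (- t) * q \<epsilon> t) ^ (n - i))
          = exp (\<epsilon>g - \<epsilon> * (real m - 2 * real j - real i) - t * real n) * (p ^ i * q \<epsilon> t ^ (n - i))"
        unfolding C_def by (intro e) simp
      show "W * (real (n choose i) * (p ^ i * q \<epsilon> t ^ (n - i))
          - C * (real (n choose i) * ((exp (\<epsilon> - t) * p) ^ i * (exp (- t) * q \<epsilon> t) ^ (n - i))))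
        = real (n choose i) * W * q \<epsilon> t ^ (n - i) * p ^ i *
          (1 - exp (\<epsilon>g - \<epsilon> * (real m - 2 * real j - real i) - t * real n))"
        unfolding mult.left_commute[of C "real (n choose i)"] * by (simp add: algebra_simps)
    qed
    finally show "(if 2 * j \<le> l then real (m choose j) * q (2 * \<epsilon>) \<epsilon> ^ (m - j) * (1 - q (2 * \<epsilon>) \<epsilon>) ^ j *
        (binomial_cdf n (l - 2 * j) p
          - exp (\<epsilon>g - \<epsilon> * (real m - 2 * real j)) * binomial_cdf n (l - 2 * j) (exp (\<epsilon> - t) * p)) else 0)
      = (\<Sum>i=0..n. if 2 * j + i \<le> l then
        real (n choose i) * real (m choose j) *
        q (2 * \<epsilon>) \<epsilon> ^ (m - j) * (1 - q (2 * \<epsilon>) \<epsilon>) ^ j *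
        q \<epsilon> t ^ (n - i) * p ^ i *
        (1 - exp (\<epsilon>g - \<epsilon> * (real m - 2 * real j - real i) - t * real n)) else 0)"
      by (simp only: W_def C_def mult.assoc)
  qed
  finally show ?thesis
    unfolding n p_def n_def[symmetric] by (subst sum.swap)
qed

text \<open>Truncation replaces each positive part by the bare expression or by \<open>0\<close>,
  neither of which is larger.\<close>

lemma trunc_delta_le_comp_delta:
  assumes "m \<le> k" "0 < \<epsilon>" "0 \<le> t" "t \<le> \<epsilon>"
  shows "trunc_delta k m \<epsilon> \<epsilon>g l t \<le> comp_delta k m \<epsilon> \<epsilon>g t"
  unfolding trunc_delta_eq[OF assms(1,2)] comp_delta_def
  using q_bounds[of \<epsilon> t] q_bounds[of "2 * \<epsilon>" \<epsilon>] assms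
  by (intro sum_mono) (auto intro!: mult_nonneg_nonneg mult_left_mono)

text \<open>The expression inside the positive part depends on \<open>i\<close> and \<open>j\<close>
  only through \<open>2 * j + i\<close>, which is at most \<open>k + m\<close>, and decreases in it.
  The positive terms thus form an initial segment, and truncation at its end loses nothing; if it is
  empty, the sum is \<open>0\<close>.\<close>

lemma comp_delta_eq_trunc_delta:
  assumes "m \<le> k" "0 < \<epsilon>"
  shows "comp_delta k m \<epsilon> \<epsilon>g t = 0 \<or> (\<exists>l\<le>k + m. comp_delta k m \<epsilon> \<epsilon>g t = trunc_delta k m \<epsilon> \<epsilon>g l t)"
proof -
  \<comment> \<open>The values of \<open>2 * j + i\<close> at which the expression inside the
    positive part is positive.\<close>
  define A where "A = {l. l \<le> k + m \<and> \<epsilon>g + \<epsilon> * (real l - real m) - t * (real k - real m) < 0}"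
  have fA: "finite A"
    unfolding A_def by (rule finite_subset[of _ "{..k + m}"]) auto
  have pos: "1 - exp (\<epsilon>g - \<epsilon> * (real m - 2 * real j - real i) - t * (real k - real m)) > 0 \<longleftrightarrow> 2 * j + i \<in> A"
    if "i \<le> k - m" "j \<le> m" for i j
    using that assms(1) by (auto simp: A_def algebra_simps)
  show ?thesis
  proof (cases "A = {}")
    case True
    have "comp_delta k m \<epsilon> \<epsilon>g t = 0"
      unfolding comp_delta_def
    proof (intro sum.neutral ballI)
      fix i j assume "i \<in> {0..k - m}" "j \<in> {0..m}"
      then have "max 0 (1 - exp (\<epsilon>g - \<epsilon> * (real m - 2 * real j - real i) - t * (real k - real m))) = 0"
        using pos[of i j] True by (intro max_absorb1) auto
      then show "real (k - m choose i) * real (m choose j) * q (2 * \<epsilon>) \<epsilon> ^ (m - j) * (1 - q (2 * \<epsilon>) \<epsilon>) ^ j *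
          q \<epsilon> t ^ (k - m - i) * (1 - q \<epsilon> t) ^ i *
          max 0 (1 - exp (\<epsilon>g - \<epsilon> * (real m - 2 * real j - real i) - t * (real k - real m))) = 0"
        by simp
    qed
    then show ?thesis ..
  next
    case False
    define l where "l = Max A"
    have l: "l \<in> A"
      using False fA by (simp add: l_def)
    have iff: "x \<in> A \<longleftrightarrow> x \<le> l" for x
    proof
      show "x \<in> A \<Longrightarrow> x \<le> l"
        using fA by (simp add: l_def)
      assume "x \<le> l"
      moreover from this have "\<epsilon> * real x \<le> \<epsilon> * real l"
        using assms(2) by simp
      ultimately show "x \<in> A"
        using l by (auto simp: A_def right_diff_distrib)
    qed
    have "comp_delta k m \<epsilon> \<epsilon>g t = trunc_delta k m \<epsilon> \<epsilon>g l t"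
      unfolding trunc_delta_eq[OF assms] comp_delta_def
    proof (intro sum.cong refl)
      fix i j assume "i \<in> {0..k - m}" "j \<in> {0..m}"
      then have "max 0 (1 - exp (\<epsilon>g - \<epsilon> * (real m - 2 * real j - real i) - t * (real k - real m)))
        = (if 2 * j + i \<le> l then 1 - exp (\<epsilon>g - \<epsilon> * (real m - 2 * real j - real i) - t * (real k - real m)) else 0)"
        using pos[of i j] by (auto simp: iff max_def)
      then show "real (k - m choose i) * real (m choose j) * q (2 * \<epsilon>) \<epsilon> ^ (m - j) * (1 - q (2 * \<epsilon>) \<epsilon>) ^ j *
          q \<epsilon> t ^ (k - m - i) * (1 - q \<epsilon> t) ^ i *
          max 0 (1 - exp (\<epsilon>g - \<epsilon> * (real m - 2 * real j - real i) - t * (real k - real m)))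
        = (if 2 * j + i \<le> l then
          real (k - m choose i) * real (m choose j) * q (2 * \<epsilon>) \<epsilon> ^ (m - j) * (1 - q (2 * \<epsilon>) \<epsilon>) ^ j *
          q \<epsilon> t ^ (k - m - i) * (1 - q \<epsilon> t) ^ i *
          (1 - exp (\<epsilon>g - \<epsilon> * (real m - 2 * real j - real i) - t * (real k - real m))) else 0)"
        by (simp split: if_splits)
    qed
    then show ?thesis
      using l by (auto simp: A_def)
  qed
qed

text \<open>By the chain rule every \<open>j\<close> contributes a nonnegative multiple of the same
  difference \<open>X - exp t\<close>, which is therefore a common factor. It is nonnegative exactly
  when \<open>t \<le> \<tau>\<close>.\<close>

lemma trunc_delta_deriv:
  fixes k m l :: nat and \<epsilon> \<epsilon>g t :: real
  assumes "m < k" "0 < \<epsilon>" "0 \<le> t" "t \<le> \<epsilon>"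
  defines "\<tau> \<equiv> (\<epsilon>g + \<epsilon> * (real l + 1 - real m)) / (real k - real m + 1)"
  shows "\<exists>R\<ge>0. (trunc_delta k m \<epsilon> \<epsilon>g l has_real_derivative
    R * (exp ((real k - real m + 1) * \<tau> - (real k - real m) * t) - exp t)) (at t)"
proof -
  obtain n where n: "k - m = Suc n"
    using assms(1) by (metis Suc_diff_Suc)
  have kn: "real k - real m = real (Suc n)"
    using assms(1) n by (simp add: of_nat_diff[symmetric])
  define c where "c = exp \<epsilon> - 1"
  have c: "c > 0"
    using assms(2) by (simp add: c_def)
  define p where "p t = 1 - q \<epsilon> t" for t
  define W where "W j = real (m choose j) * q (2 * \<epsilon>) \<epsilon> ^ (m - j) * (1 - q (2 * \<epsilon>) \<epsilon>) ^ j" for j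
  define C where "C j = exp (\<epsilon>g - \<epsilon> * (real m - 2 * real j))" for j
  define R where "R j = real (Suc n) * real (n choose (l - 2 * j)) * p t ^ (l - 2 * j) * (1 - p t) ^ (n - (l - 2 * j)) / c" for j
  define X where "X = exp ((real k - real m + 1) * \<tau> - (real k - real m) * t)"
  have p: "p = (\<lambda>t. (exp t - 1) / c)"
  proof
    fix t
    have "1 - exp (- \<epsilon>) = exp (- \<epsilon>) * c" "1 - exp (t - \<epsilon>) = exp (- \<epsilon>) * (exp \<epsilon> - exp t)"
      by (simp_all add: c_def algebra_simps flip: exp_add)
    then have "q \<epsilon> t = (exp \<epsilon> - exp t) / c"
      unfolding q_def by simp
    then show "p t = (exp t - 1) / c"
      using c by (simp add: p_def field_simps) (simp add: c_def)
  qed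
  have p': "(\<lambda>t. exp (\<epsilon> - t) * p t) = (\<lambda>t. exp \<epsilon> * (1 - exp (- t)) / c)"
    unfolding p by (rule ext) (simp add: exp_diff exp_minus field_simps)
  have dp: "(p has_real_derivative exp t / c) (at t)"
    unfolding p using c by (auto intro!: derivative_eq_intros)
  have dp': "((\<lambda>t. exp (\<epsilon> - t) * p t) has_real_derivative exp (\<epsilon> - t) / c) (at t)"
    unfolding p' using c by (auto intro!: derivative_eq_intros simp: exp_diff exp_minus field_simps)
  have q': "1 - exp (\<epsilon> - t) * p t = exp (- t) * (1 - p t)"
    using c unfolding p by (simp add: exp_diff exp_minus field_simps) (simp add: c_def algebra_simps)
  have main: "((\<lambda>t. W j * (binomial_cdf (Suc n) (l - 2 * j) (p t) - C j * binomial_cdf (Suc n) (l - 2 * j) (exp (\<epsilon> - t) * p t)))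
     has_real_derivative W j * R j * (X - exp t)) (at t)" if "2 * j \<le> l" for j
  proof -
    define a where "a = l - 2 * j"
    have D: "((\<lambda>t. W j * (binomial_cdf (Suc n) a (p t) - C j * binomial_cdf (Suc n) a (exp (\<epsilon> - t) * p t)))
      has_real_derivative W j * ((- real (Suc n) * real (n choose a) * p t ^ a * (1 - p t) ^ (n - a)) * (exp t / c)
        - C j * ((- real (Suc n) * real (n choose a) * (exp (\<epsilon> - t) * p t) ^ a * (1 - exp (\<epsilon> - t) * p t) ^ (n - a))
            * (exp (\<epsilon> - t) / c)))) (at t)"
      by (intro DERIV_cmult DERIV_diff DERIV_chain2[OF binomial_cdf_deriv dp] DERIV_chain2[OF binomial_cdf_deriv dp'])
    \<comment> \<open>The dependence on \<open>j\<close> cancels because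
      \<open>a + 2 * j = l\<close>. The extra factor \<open>exp (\<epsilon> - t)\<close>, from the
      inner derivative \<open>dp'\<close>, accounts for the \<open>+ 1\<close> in the numerator of
      \<open>\<tau>\<close>. For \<open>n < a\<close> both sides are \<open>0\<close>.\<close>
    have key: "real (n choose a) * (C j * (exp (\<epsilon> - t) ^ a * exp (- t) ^ (n - a) * exp (\<epsilon> - t))) = real (n choose a) * X"
    proof (cases "a \<le> n")
      case True
      have "(real k - real m + 1) * \<tau> = \<epsilon>g + \<epsilon> * (real l + 1 - real m)"
        unfolding \<tau>_def using assms(1) by simp
      moreover have "real l = real a + 2 * real j"
        using that by (simp add: a_def)
      ultimately have "C j * (exp (\<epsilon> - t) ^ a * exp (- t) ^ (n - a) * exp (\<epsilon> - t)) = X"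
        unfolding C_def X_def exp_of_nat_mult[symmetric] exp_add[symmetric] of_nat_diff[OF True] kn
        by (simp add: algebra_simps)
      then show ?thesis
        by simp
    qed simp
    have "(- real (Suc n) * real (n choose a) * p t ^ a * (1 - p t) ^ (n - a)) * (exp t / c)
        - C j * ((- real (Suc n) * real (n choose a) * (exp (\<epsilon> - t) * p t) ^ a * (1 - exp (\<epsilon> - t) * p t) ^ (n - a))
            * (exp (\<epsilon> - t) / c))
      = real (Suc n) * p t ^ a * (1 - p t) ^ (n - a) / c *
          (real (n choose a) * (C j * (exp (\<epsilon> - t) ^ a * exp (- t) ^ (n - a) * exp (\<epsilon> - t))) - real (n choose a) * exp t)"
      unfolding q' power_mult_distrib divide_inverse by algebra
    also have "\<dots> = R j * (X - exp t)"
      unfolding key R_def a_def[symmetric] divide_inverse by algebra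
    finally show ?thesis
      using D unfolding a_def[symmetric] by (simp only: mult.assoc)
  qed
  let ?J = "{j. j \<le> m \<and> 2 * j \<le> l}"
  have fJ: "finite ?J"
    by (rule finite_subset[of _ "{..m}"]) auto
  have eq: "trunc_delta k m \<epsilon> \<epsilon>g l = (\<lambda>t. \<Sum>j\<in>?J. W j *
      (binomial_cdf (Suc n) (l - 2 * j) (p t) - C j * binomial_cdf (Suc n) (l - 2 * j) (exp (\<epsilon> - t) * p t)))"
    by (rule ext) (simp add: trunc_delta_def n W_def C_def p_def)
  have "(trunc_delta k m \<epsilon> \<epsilon>g l has_real_derivative (\<Sum>j\<in>?J. W j * R j * (X - exp t))) (at t)"
    unfolding eq by (intro DERIV_sum main) simp
  then have "(trunc_delta k m \<epsilon> \<epsilon>g l has_real_derivative (\<Sum>j\<in>?J. W j * R j) * (X - exp t)) (at t)"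
    by (simp add: sum_distrib_right)
  moreover have "0 \<le> W j * R j" for j
    using q_bounds[of \<epsilon> t] q_bounds[of "2 * \<epsilon>" \<epsilon>] assms(2-4) c
    by (simp add: W_def R_def p_def)
  ultimately show ?thesis
    unfolding X_def by (intro exI[of _ "\<Sum>j\<in>?J. W j * R j"] conjI sum_nonneg) auto
qed

section \<open>Maximality at the clamped points\<close>

lemma t_pt_bounds:
  assumes "0 < \<epsilon>"
  shows "0 \<le> t_pt k m \<epsilon> \<epsilon>g l" "t_pt k m \<epsilon> \<epsilon>g l \<le> \<epsilon>"
  using assms by (auto simp: t_pt_def Let_def)

lemma t_pt_cases:
  fixes k m l :: nat and \<epsilon> \<epsilon>g :: real
  assumes "0 < \<epsilon>"
  defines "\<tau> \<equiv> (\<epsilon>g + \<epsilon> * (real l + 1 - real m)) / (real k - real m + 1)"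
  shows "t_pt k m \<epsilon> \<epsilon>g l = \<tau> \<or> (t_pt k m \<epsilon> \<epsilon>g l = 0 \<and> \<tau> < 0) \<or> (t_pt k m \<epsilon> \<epsilon>g l = \<epsilon> \<and> \<epsilon> < \<tau>)"
  unfolding t_pt_def Let_def \<tau>_def[symmetric] using assms(1) by (auto simp: dist_real_def)

text \<open>On \<open>{0..\<epsilon>}\<close> the truncation is nondecreasing up to
  \<open>\<tau>\<close> and nonincreasing after it, so its maximum is at the point of the interval
  nearest to \<open>\<tau>\<close>.\<close>

lemma trunc_delta_le_t_pt:
  assumes "m \<le> k" "0 < \<epsilon>" "0 \<le> t" "t \<le> \<epsilon>"
  shows "trunc_delta k m \<epsilon> \<epsilon>g l t \<le> trunc_delta k m \<epsilon> \<epsilon>g l (t_pt k m \<epsilon> \<epsilon>g l)"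
\<comment> \<open>Without bounded-range factors the truncation is constant in \<open>t\<close>, as
  \<open>binomial_cdf 0\<close> is constantly 1.\<close>
proof (cases "m = k")
  case True
  then show ?thesis
    by (simp add: trunc_delta_def)
next
  case False
  then have mk: "m < k"
    using assms(1) by simp
  define \<tau> where "\<tau> = (\<epsilon>g + \<epsilon> * (real l + 1 - real m)) / (real k - real m + 1)"
  define s where "s = t_pt k m \<epsilon> \<epsilon>g l"
  have s: "0 \<le> s" "s \<le> \<epsilon>" "s = \<tau> \<or> (s = 0 \<and> \<tau> < 0) \<or> (s = \<epsilon> \<and> \<epsilon> < \<tau>)"
    using t_pt_bounds[OF assms(2), of k m \<epsilon>g l] t_pt_cases[OF assms(2), of k m \<epsilon>g l]
    by (auto simp: s_def \<tau>_def)
  have sign: "x \<le> (real k - real m + 1) * \<tau> - (real k - real m) * x \<longleftrightarrow> x \<le> \<tau>"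
     "(real k - real m + 1) * \<tau> - (real k - real m) * x \<le> x \<longleftrightarrow> \<tau> \<le> x" for x
  proof -
    have "(real k - real m + 1) * \<tau> - (real k - real m) * x - x = (real k - real m + 1) * (\<tau> - x)"
      by (simp add: algebra_simps)
    moreover have "0 \<le> (real k - real m + 1) * (\<tau> - x) \<longleftrightarrow> 0 \<le> \<tau> - x" "(real k - real m + 1) * (\<tau> - x) \<le> 0 \<longleftrightarrow> \<tau> - x \<le> 0"
      using mk by (simp_all add: zero_le_mult_iff mult_le_0_iff)
    ultimately show "x \<le> (real k - real m + 1) * \<tau> - (real k - real m) * x \<longleftrightarrow> x \<le> \<tau>"
       "(real k - real m + 1) * \<tau> - (real k - real m) * x \<le> x \<longleftrightarrow> \<tau> \<le> x"
      by linarith+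
  qed
  have deriv: "\<exists>R\<ge>0. (trunc_delta k m \<epsilon> \<epsilon>g l has_real_derivative
      R * (exp ((real k - real m + 1) * \<tau> - (real k - real m) * x) - exp x)) (at x)" if "0 \<le> x" "x \<le> \<epsilon>" for x
    unfolding \<tau>_def by (rule trunc_delta_deriv[OF mk assms(2) that])
  show ?thesis
    unfolding s_def[symmetric]
  proof (cases t s rule: linorder_cases)
    case less
    show "trunc_delta k m \<epsilon> \<epsilon>g l t \<le> trunc_delta k m \<epsilon> \<epsilon>g l s"
    proof (rule DERIV_nonneg_imp_nondecreasing[where f = "trunc_delta k m \<epsilon> \<epsilon>g l"])
      fix x assume x: "t \<le> x" "x \<le> s"
      then obtain R where R: "0 \<le> R" "(trunc_delta k m \<epsilon> \<epsilon>g l has_real_derivative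
          R * (exp ((real k - real m + 1) * \<tau> - (real k - real m) * x) - exp x)) (at x)"
        using deriv[of x] assms s by auto
      have "x \<le> \<tau>"
        using x s(3) less assms by auto
      then have "0 \<le> R * (exp ((real k - real m + 1) * \<tau> - (real k - real m) * x) - exp x)"
        using R(1) by (simp add: sign)
      with R(2) show "\<exists>y. (trunc_delta k m \<epsilon> \<epsilon>g l has_real_derivative y) (at x) \<and> 0 \<le> y"
        by blast
    qed (use less in simp)
  next
    case greater
    show "trunc_delta k m \<epsilon> \<epsilon>g l t \<le> trunc_delta k m \<epsilon> \<epsilon>g l s"
    proof (rule DERIV_nonpos_imp_nonincreasing[where f = "trunc_delta k m \<epsilon> \<epsilon>g l"])
      fix x assume x: "s \<le> x" "x \<le> t"
      then obtain R where R: "0 \<le> R" "(trunc_delta k m \<epsilon> \<epsilon>g l has_real_derivative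
          R * (exp ((real k - real m + 1) * \<tau> - (real k - real m) * x) - exp x)) (at x)"
        using deriv[of x] assms s by auto
      have "\<tau> \<le> x"
        using x s(3) greater assms by auto
      then have "R * (exp ((real k - real m + 1) * \<tau> - (real k - real m) * x) - exp x) \<le> 0"
        using R(1) by (simp add: sign mult_nonneg_nonpos)
      with R(2) show "\<exists>y. (trunc_delta k m \<epsilon> \<epsilon>g l has_real_derivative y) (at x) \<and> y \<le> 0"
        by blast
    qed (use greater in simp)
  qed simp
qed

lemma comp_delta_nonneg:
  assumes "0 < \<epsilon>" "0 \<le> t" "t \<le> \<epsilon>"
  shows "0 \<le> comp_delta k m \<epsilon> \<epsilon>g t"
  unfolding comp_delta_def
  using q_bounds[of \<epsilon> t] q_bounds[of "2 * \<epsilon>" \<epsilon>] assms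
  by (intro sum_nonneg mult_nonneg_nonneg) auto

text \<open>The full sum at \<open>t\<close> equals some truncation at \<open>t\<close>, which is at
  most the same truncation at \<open>t_pt\<close>, hence at most the full sum there. A vanishing sum
  is covered by nonnegativity.\<close>

lemma comp_delta_le_Max:
  assumes "m \<le> k" "0 < \<epsilon>" "0 \<le> t" "t \<le> \<epsilon>"
  shows "comp_delta k m \<epsilon> \<epsilon>g t \<le> (MAX l\<in>{0..k + m}. comp_delta k m \<epsilon> \<epsilon>g (t_pt k m \<epsilon> \<epsilon>g l))"
proof -
  have Max: "comp_delta k m \<epsilon> \<epsilon>g (t_pt k m \<epsilon> \<epsilon>g l) \<le> (MAX l\<in>{0..k + m}. comp_delta k m \<epsilon> \<epsilon>g (t_pt k m \<epsilon> \<epsilon>g l))"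
    if "l \<le> k + m" for l
    using that by (intro Max_ge) auto
  consider "comp_delta k m \<epsilon> \<epsilon>g t = 0" | l where "l \<le> k + m" "comp_delta k m \<epsilon> \<epsilon>g t = trunc_delta k m \<epsilon> \<epsilon>g l t"
    using comp_delta_eq_trunc_delta[OF assms(1,2), of \<epsilon>g t] by blast
  then show ?thesis
  proof cases
    case 1
    have "0 \<le> comp_delta k m \<epsilon> \<epsilon>g (t_pt k m \<epsilon> \<epsilon>g 0)"
      by (rule comp_delta_nonneg[OF assms(2) t_pt_bounds[OF assms(2)]])
    with 1 Max[OF le0] show ?thesis
      by linarith
  next
    case 2
    have "trunc_delta k m \<epsilon> \<epsilon>g l t \<le> trunc_delta k m \<epsilon> \<epsilon>g l (t_pt k m \<epsilon> \<epsilon>g l)"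
      by (rule trunc_delta_le_t_pt[OF assms])
    also have "\<dots> \<le> comp_delta k m \<epsilon> \<epsilon>g (t_pt k m \<epsilon> \<epsilon>g l)"
      by (rule trunc_delta_le_comp_delta[OF assms(1,2) t_pt_bounds[OF assms(2)]])
    finally show ?thesis
      using 2 Max[of l] by linarith
  qed
qed

subsection \<open>Privacy of mechanisms and their compositions\<close>

text \<open>Take \<open>exp t\<close> to be the supremum of the likelihood ratio over possible
  outcomes; bounded range keeps all ratios above \<open>exp (t - \<epsilon>)\<close>. Normalization
  of both distributions forces 1 into this interval, which bounds \<open>t\<close>.\<close>

lemma BR_class_pair:
  assumes "M \<in> BR_class nb \<epsilon>" "nb x x'"
  obtains t where "0 \<le> t" "t \<le> \<epsilon>"
    "\<And>S. S \<in> sets (M x') \<Longrightarrow>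
      exp (t - \<epsilon>) * measure (M x') S \<le> measure (M x) S \<and> measure (M x) S \<le> exp t * measure (M x') S"
proof -
  interpret P: prob_space "M x"
    using assms by (auto simp: BR_class_def is_mechanism_def)
  interpret Q: prob_space "M x'"
    using assms by (auto simp: BR_class_def is_mechanism_def)
  obtain \<mu> f g where [measurable]: "f \<in> borel_measurable \<mu>" "g \<in> borel_measurable \<mu>"
    and Mx: "M x = density \<mu> f" and Mx': "M x' = density \<mu> g"
    and ratio: "\<And>y1 y2. y1 \<in> space \<mu> \<Longrightarrow> f y1 \<noteq> 0 \<or> g y1 \<noteq> 0 \<Longrightarrow> y2 \<in> space \<mu> \<Longrightarrow> f y2 \<noteq> 0 \<or> g y2 \<noteq> 0 \<Longrightarrow>
      f y1 / g y1 \<le> ennreal (exp \<epsilon>) * (f y2 / g y2)"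
    using assms unfolding BR_class_def is_BR_def by (simp add: Ball_def) metis
  have f1: "(\<integral>\<^sup>+y. f y \<partial>\<mu>) = 1"
    using P.emeasure_space_1 by (simp add: Mx emeasure_density cong: nn_integral_cong_simp)
  have g1: "(\<integral>\<^sup>+y. g y \<partial>\<mu>) = 1"
    using Q.emeasure_space_1 by (simp add: Mx' emeasure_density cong: nn_integral_cong_simp)
  have fin: "AE y in \<mu>. f y \<noteq> \<infinity> \<and> g y \<noteq> \<infinity>"
    using nn_integral_PInf_AE[of f \<mu>] nn_integral_PInf_AE[of g \<mu>] f1 g1 by auto
  \<comment> \<open>Such an outcome exists because \<open>g\<close> integrates to 1. Its ratio is
    finite, and by bounded range this makes the supremum \<open>b\<close> finite.\<close>
  have "\<exists>y\<in>space \<mu>. f y \<noteq> \<infinity> \<and> g y \<noteq> \<infinity> \<and> g y \<noteq> 0"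
  proof (rule ccontr)
    assume *: "\<not> ?thesis"
    have "AE y in \<mu>. g y = 0"
      using fin AE_space by eventually_elim (use * in auto)
    then have "(\<integral>\<^sup>+y. g y \<partial>\<mu>) = 0"
      by (simp add: nn_integral_0_iff_AE)
    with g1 show False
      by simp
  qed
  then obtain y0 where y0: "y0 \<in> space \<mu>" "f y0 \<noteq> \<infinity>" "g y0 \<noteq> \<infinity>" "g y0 \<noteq> 0"
    by blast
  define A where "A = {y \<in> space \<mu>. f y \<noteq> 0 \<or> g y \<noteq> 0}"
  define b where "b = (SUP y\<in>A. f y / g y)"
  have b_le: "b \<le> ennreal (exp \<epsilon>) * (f y / g y)" if "y \<in> A" for y
    unfolding b_def using ratio that by (intro SUP_least) (auto simp: A_def)
  have le_b: "f y / g y \<le> b" if "y \<in> A" for y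
    unfolding b_def using that by (rule SUP_upper)
  have "f y0 / g y0 \<noteq> \<infinity>"
    using y0 by (simp add: ennreal_divide_eq_top_iff)
  then have "b \<noteq> \<infinity>"
    using b_le[of y0] y0 by (auto simp: A_def top_unique ennreal_mult_eq_top_iff)
  have AE: "AE y in \<mu>. f y \<le> b * g y \<and> b * g y \<le> ennreal (exp \<epsilon>) * f y"
    using fin AE_space
  proof eventually_elim
    case (elim y)
    show ?case
    proof (cases "y \<in> A")
      case True
      \<comment> \<open>Otherwise the ratio at a possible outcome would be infinite.\<close>
      have "g y \<noteq> 0"
      proof
        assume "g y = 0"
        with True have "f y / g y = \<infinity>"
          by (simp add: A_def ennreal_divide_zero)
        with le_b[OF True] \<open>b \<noteq> \<infinity>\<close> show False
          by (simp add: top_unique)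
      qed
      with elim have "f y / g y * g y = f y"
        by (simp add: ennreal_divide_times ennreal_divide_self less_top)
      then show ?thesis
        using mult_right_mono[OF le_b[OF True], of "g y"] mult_right_mono[OF b_le[OF True], of "g y"]
        by (simp add: mult.assoc)
    qed (use elim in \<open>auto simp: A_def\<close>)
  qed
  have em: "emeasure (M x) S \<le> b * emeasure (M x') S"
    "b * emeasure (M x') S \<le> ennreal (exp \<epsilon>) * emeasure (M x) S" if "S \<in> sets (M x')" for S
  proof -
    have [measurable]: "S \<in> sets \<mu>"
      using that by (simp add: Mx')
    have "(\<integral>\<^sup>+y. f y * indicator S y \<partial>\<mu>) \<le> (\<integral>\<^sup>+y. b * (g y * indicator S y) \<partial>\<mu>)"
      using AE by (intro nn_integral_mono_AE) (auto simp: indicator_def)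
    then show "emeasure (M x) S \<le> b * emeasure (M x') S"
      by (simp add: Mx Mx' emeasure_density nn_integral_cmult)
    have "(\<integral>\<^sup>+y. b * (g y * indicator S y) \<partial>\<mu>) \<le> (\<integral>\<^sup>+y. ennreal (exp \<epsilon>) * (f y * indicator S y) \<partial>\<mu>)"
      using AE by (intro nn_integral_mono_AE) (auto simp: indicator_def)
    then show "b * emeasure (M x') S \<le> ennreal (exp \<epsilon>) * emeasure (M x) S"
      by (simp add: Mx Mx' emeasure_density nn_integral_cmult)
  qed
  obtain c where c: "b = ennreal c" "0 \<le> c"
    using \<open>b \<noteq> \<infinity>\<close> by (cases b) auto
  have m: "measure (M x) S \<le> c * measure (M x') S" "c * measure (M x') S \<le> exp \<epsilon> * measure (M x) S"
    if "S \<in> sets (M x')" for S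
    using em[OF that] c(2) unfolding c(1) P.emeasure_eq_measure Q.emeasure_eq_measure
    by (simp_all flip: ennreal_mult)
  have "space (M x) = space (M x')"
    by (simp add: Mx Mx')
  \<comment> \<open>The setwise bounds are evaluated on the whole space, where both measures are
    1.\<close>
  then have c_bounds: "1 \<le> c" "c \<le> exp \<epsilon>"
    using m[OF sets.top] P.prob_space Q.prob_space by auto
  show thesis
  proof (rule that[of "ln c"])
    have "ln c \<le> ln (exp \<epsilon>)"
      using c_bounds by (subst ln_le_cancel_iff) auto
    then show "0 \<le> ln c" "ln c \<le> \<epsilon>"
      using c_bounds by auto
    fix S assume "S \<in> sets (M x')"
    then show "exp (ln c - \<epsilon>) * measure (M x') S \<le> measure (M x) S
        \<and> measure (M x) S \<le> exp (ln c) * measure (M x') S"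
      using m[of S] c_bounds by (simp add: exp_diff divide_simps mult.commute)
  qed
qed

text \<open>The lower bound is the DP inequality for the reversed pair. The ratio interval is thus
  the one with \<open>t = \<epsilon>\<close> and \<open>r = 2 * \<epsilon>\<close>.\<close>

lemma DP_class_pair:
  assumes "M \<in> DP_class nb \<epsilon>" "symp nb" "nb x x'" "S \<in> sets (M x')"
  shows "exp (- \<epsilon>) * measure (M x') S \<le> measure (M x) S \<and> measure (M x) S \<le> exp \<epsilon> * measure (M x') S"
proof -
  have "S \<in> sets (M x)" "nb x' x"
    using assms by (auto simp: DP_class_def is_mechanism_def dest: sympD)
  then have "measure (M x) S \<le> exp \<epsilon> * measure (M x') S" "measure (M x') S \<le> exp \<epsilon> * measure (M x) S"
    using assms unfolding DP_class_def is_DP_def by fastforce+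
  then show ?thesis
    by (simp add: exp_minus divide_simps mult.commute)
qed

section \<open>Randomized response as the extremal mechanism\<close>

lemma randomized_response:
  fixes y y' :: 'y
  assumes "y \<noteq> y'" "0 \<le> t" "t \<le> r" "0 < r"
  obtains Q :: "'y measure" and h :: "'y \<Rightarrow> real"
  where "prob_space Q" "h \<in> borel_measurable Q" "\<And>z. h z \<in> {exp (t - r), exp t}"
    "prob_space (density Q (\<lambda>z. ennreal (h z)))"
proof -
  \<comment> \<open>The probability of \<open>y\<close> for which \<open>h\<close> has mean 1 under
    \<open>Q\<close>.\<close>
  define w where "w = (1 - exp (t - r)) / (exp t - exp (t - r))"
  have lt: "exp (t - r) < exp t"
    using assms by simp
  then have w: "0 \<le> w" "w \<le> 1" "w * exp t + (1 - w) * exp (t - r) = 1"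
    using assms by (auto simp: w_def divide_simps) (simp_all add: algebra_simps)
  define Q where "Q = map_pmf (\<lambda>b. if b then y else y') (bernoulli_pmf w)"
  \<comment> \<open>Every point other than \<open>y\<close> receives the lower value, so
    \<open>h\<close> is two-valued on the whole type and not only on the support.\<close>
  define h where "h z = (if z = y then exp t else exp (t - r))" for z
  have "(\<integral>\<^sup>+z. ennreal (h z) \<partial>measure_pmf Q) = ennreal (exp t) * ennreal w + ennreal (exp (t - r)) * ennreal (1 - w)"
    using w assms(1) by (simp add: Q_def h_def)
  also have "\<dots> = 1"
    using w by (simp add: mult.commute flip: ennreal_mult ennreal_plus)
  finally have "prob_space (density Q (\<lambda>z. ennreal (h z)))"
    by (intro prob_spaceI) (simp add: emeasure_density)
  then show thesis
    by (intro that[of "measure_pmf Q" h]) (auto simp: h_def measure_pmf.prob_space_axioms)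
qed

text \<open>The input \<open>x0\<close> yields the tilted distribution and every other input yields
  \<open>Q\<close>, so the likelihood ratio of any two inputs is \<open>h\<close>, its reciprocal or
  1.\<close>

lemma density_mechanism:
  assumes "prob_space Q" "h \<in> borel_measurable Q" "prob_space (density Q (\<lambda>z. ennreal (h z)))"
  shows "is_mechanism (\<lambda>x. density Q (\<lambda>z. ennreal (if x = x0 then h z else 1)))"
  unfolding is_mechanism_def
proof (intro exI allI conjI)
  show "prob_space (density Q (\<lambda>z. ennreal (if x = x0 then h z else 1)))" for x
    using assms by (cases "x = x0") (simp_all add: density_1)
qed simp

text \<open>All outputs have densities with respect to \<open>Q\<close>. The two values of
  \<open>h\<close> differ by the factor \<open>exp \<epsilon>\<close>, which bounds the spread of
  each possible likelihood ratio.\<close>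

lemma density_in_BR_class:
  assumes "prob_space Q" "h \<in> borel_measurable Q" "prob_space (density Q (\<lambda>z. ennreal (h z)))"
    and h: "\<And>z. h z \<in> {exp (t - \<epsilon>), exp t}" and "0 < \<epsilon>"
  shows "(\<lambda>x. density Q (\<lambda>z. ennreal (if x = x0 then h z else 1))) \<in> BR_class nb \<epsilon>"
proof -
  have pos: "0 < h z" for z
    using h[of z] by auto
  have le: "h z \<le> exp \<epsilon> * h z'" for z z'
    using h[of z] h[of z'] assms(5) by (auto simp flip: exp_add)
  have "\<exists>\<mu> f g. sigma_finite_measure \<mu> \<and> f \<in> borel_measurable \<mu> \<and> g \<in> borel_measurable \<mu> \<and>
      density Q (\<lambda>z. ennreal (if x = x0 then h z else 1)) = density \<mu> f \<and>
      density Q (\<lambda>z. ennreal (if x' = x0 then h z else 1)) = density \<mu> g \<and>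
      (\<forall>y1\<in>{y \<in> space \<mu>. f y \<noteq> 0 \<or> g y \<noteq> 0}. \<forall>y2\<in>{y \<in> space \<mu>. f y \<noteq> 0 \<or> g y \<noteq> 0}.
         f y1 / g y1 \<le> ennreal (exp \<epsilon>) * (f y2 / g y2))" for x x'
  proof (intro exI conjI ballI)
    fix z z'
    have "(if x = x0 then h z else 1) / (if x' = x0 then h z else 1)
        \<le> exp \<epsilon> * ((if x = x0 then h z' else 1) / (if x' = x0 then h z' else 1))"
      using pos[of z] pos[of z'] le[of z z'] le[of z' z] assms(5)
      by (auto simp: divide_simps mult.commute)
    then show "ennreal (if x = x0 then h z else 1) / ennreal (if x' = x0 then h z else 1)
        \<le> ennreal (exp \<epsilon>) * (ennreal (if x = x0 then h z' else 1) / ennreal (if x' = x0 then h z' else 1))"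
      using pos[of z] pos[of z'] by (subst (1 2) divide_ennreal) (auto simp flip: ennreal_mult intro: less_imp_le)
  qed (use assms in \<open>auto intro: prob_space_imp_sigma_finite\<close>)
  then show ?thesis
    using density_mechanism[OF assms(1-3)] by (simp add: BR_class_def is_BR_def)
qed

text \<open>The density on one input is pointwise at most \<open>exp \<epsilon>\<close> times that
  on another; integration over an event gives the inequality of probabilities.\<close>

lemma density_in_DP_class:
  assumes "prob_space Q" "h \<in> borel_measurable Q" "prob_space (density Q (\<lambda>z. ennreal (h z)))"
    and h: "\<And>z. h z \<in> {exp (- \<epsilon>), exp \<epsilon>}" and "0 < \<epsilon>"
  shows "(\<lambda>x. density Q (\<lambda>z. ennreal (if x = x0 then h z else 1))) \<in> DP_class nb \<epsilon>"
proof -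
  let ?M = "\<lambda>x. density Q (\<lambda>z. ennreal (if x = x0 then h z else 1))"
  have pos: "0 < h z" for z
    using h[of z] by auto
  have le: "(if x = x0 then h z else 1) \<le> exp \<epsilon> * (if x' = x0 then h z else 1)" for x x' z
    using h[of z] assms(5) by (auto simp flip: exp_add)
  have M: "is_mechanism ?M"
    by (rule density_mechanism[OF assms(1-3)])
  have "measure (?M x) S \<le> exp \<epsilon> * measure (?M x') S" if "S \<in> sets Q" for x x' S
  proof -
    note [measurable] = assms(2) that
    interpret P: prob_space "?M x"
      using M by (auto simp: is_mechanism_def)
    interpret P': prob_space "?M x'"
      using M by (auto simp: is_mechanism_def)
    have "emeasure (?M x) S = (\<integral>\<^sup>+z. ennreal (if x = x0 then h z else 1) * indicator S z \<partial>Q)"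
      by (simp add: emeasure_density)
    also have "\<dots> \<le> (\<integral>\<^sup>+z. ennreal (exp \<epsilon>) * (ennreal (if x' = x0 then h z else 1) * indicator S z) \<partial>Q)"
    proof (rule nn_integral_mono)
      fix z
      have "ennreal (if x = x0 then h z else 1) \<le> ennreal (exp \<epsilon>) * ennreal (if x' = x0 then h z else 1)"
        using le[of x z x'] pos[of z] by (subst ennreal_mult[symmetric]) (auto intro: less_imp_le)
      then show "ennreal (if x = x0 then h z else 1) * indicator S z
          \<le> ennreal (exp \<epsilon>) * (ennreal (if x' = x0 then h z else 1) * indicator S z)"
        by (auto simp: indicator_def)
    qed
    also have "\<dots> = ennreal (exp \<epsilon>) * emeasure (?M x') S"
      by (simp add: emeasure_density nn_integral_cmult)
    finally show ?thesis
      by (simp add: P.emeasure_eq_measure P'.emeasure_eq_measure flip: ennreal_mult)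
  qed
  with M show ?thesis
    by (simp add: DP_class_def is_DP_def)
qed

text \<open>For a fixed pair of neighbors, each factor supplies a ratio interval. The excess of an
  event is then bounded by \<open>rr_exp\<close>, the bounded-range parameters are averaged, and the
  result is some \<open>comp_delta\<close> at a common \<open>\<tau>\<close>.\<close>

lemma composition_is_DP:
  assumes "symp nb" "0 < \<epsilon>" "1 \<le> k" "m \<le> k" "length Cs = k" "B \<subseteq> {..<k}" "card B = k - m"
    and Cs: "\<And>i. i < k \<Longrightarrow> Cs ! i = (if i \<in> B then BR_class nb \<epsilon> else DP_class nb \<epsilon>)"
    and M: "M \<in> composition Cs"
  shows "is_DP nb \<epsilon>g (MAX l\<in>{0..k + m}. comp_delta k m \<epsilon> \<epsilon>g (t_pt k m \<epsilon> \<epsilon>g l)) M"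
proof -
  define r where "r i = (if i \<in> B then \<epsilon> else 2 * \<epsilon>)" for i
  obtain Ms where Ms: "\<And>i. i < k \<Longrightarrow> Ms i \<in> Cs ! i" and M_eq: "M = (\<lambda>x. PiM {..<k} (\<lambda>i. Ms i x))"
    using M assms(5) by (auto simp: composition_def)
  \<comment> \<open>Indices outside the list are sent to factor \<open>0\<close>, because
    \<open>bounded_densities\<close> asks for its conditions at every index. Below \<open>k\<close>
    nothing changes, so the product is the same.\<close>
  define \<iota> where "\<iota> i = (if i < k then i else 0)" for i
  have \<iota>: "\<iota> i < k" for i
    using assms(3) by (simp add: \<iota>_def)
  have mech: "is_mechanism (Ms (\<iota> i))" for i
    using Ms[OF \<iota>[of i]] Cs[OF \<iota>[of i]] by (auto simp: BR_class_def DP_class_def split: if_splits)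
  have "measure (M x) S \<le> exp \<epsilon>g * measure (M x') S
      + (MAX l\<in>{0..k + m}. comp_delta k m \<epsilon> \<epsilon>g (t_pt k m \<epsilon> \<epsilon>g l))"
    if nb: "nb x x'" and S: "S \<in> sets (M x)" for x x' S
  proof -
    have "\<exists>t. 0 \<le> t \<and> t \<le> r (\<iota> i) \<and> (\<iota> i \<notin> B \<longrightarrow> t = \<epsilon>) \<and> (\<forall>S\<in>sets (Ms (\<iota> i) x').
        exp (t - r (\<iota> i)) * measure (Ms (\<iota> i) x') S \<le> measure (Ms (\<iota> i) x) S
        \<and> measure (Ms (\<iota> i) x) S \<le> exp t * measure (Ms (\<iota> i) x') S)" for i
    proof (cases "\<iota> i \<in> B")
      case True
      then have BR: "Ms (\<iota> i) \<in> BR_class nb \<epsilon>"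
        using Ms[OF \<iota>[of i]] Cs[OF \<iota>[of i]] by simp
      obtain s where "0 \<le> s" "s \<le> \<epsilon>" "\<And>S. S \<in> sets (Ms (\<iota> i) x') \<Longrightarrow>
          exp (s - \<epsilon>) * measure (Ms (\<iota> i) x') S \<le> measure (Ms (\<iota> i) x) S
          \<and> measure (Ms (\<iota> i) x) S \<le> exp s * measure (Ms (\<iota> i) x') S"
        by (rule BR_class_pair[OF BR nb]) (rule that)
      then show ?thesis
        using True by (intro exI[of _ s]) (simp add: r_def)
    next
      case False
      then have "Ms (\<iota> i) \<in> DP_class nb \<epsilon>"
        using Ms[OF \<iota>[of i]] Cs[OF \<iota>[of i]] by simp
      from DP_class_pair[OF this assms(1) nb] show ?thesis
        using False assms(2) by (intro exI[of _ \<epsilon>]) (auto simp: r_def)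
    qed
    then obtain t where t: "\<And>i. 0 \<le> t i \<and> t i \<le> r (\<iota> i)" "\<And>i. \<iota> i \<notin> B \<Longrightarrow> t i = \<epsilon>"
      and pair: "\<And>i S. S \<in> sets (Ms (\<iota> i) x') \<Longrightarrow>
        exp (t i - r (\<iota> i)) * measure (Ms (\<iota> i) x') S \<le> measure (Ms (\<iota> i) x) S
        \<and> measure (Ms (\<iota> i) x) S \<le> exp (t i) * measure (Ms (\<iota> i) x') S"
      by metis
    have r_pos: "0 < r i" for i
      using assms(2) by (simp add: r_def)
    have prob: "prob_space (Ms (\<iota> i) z)" for i z
      using mech[of i] by (auto simp: is_mechanism_def)
    have "\<exists>h. h \<in> borel_measurable (Ms (\<iota> i) x') \<and> (\<forall>y. exp (t i - r (\<iota> i)) \<le> h y \<and> h y \<le> exp (t i))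
        \<and> Ms (\<iota> i) x = density (Ms (\<iota> i) x') (\<lambda>y. ennreal (h y))" for i
    proof -
      have "sets (Ms (\<iota> i) x) = sets (Ms (\<iota> i) x')"
        using mech[of i] by (auto simp: is_mechanism_def)
      moreover have "exp (t i - r (\<iota> i)) \<le> exp (t i)"
        using r_pos[of "\<iota> i"] by simp
      ultimately show ?thesis
        using density_eq_bounds[OF prob prob, of i x i x' "exp (t i - r (\<iota> i))" "exp (t i)"] pair[of _ i]
        by (metis exp_ge_zero)
    qed
    then obtain h where h: "\<And>i. h i \<in> borel_measurable (Ms (\<iota> i) x')"
      "\<And>i y. exp (t i - r (\<iota> i)) \<le> h i y \<and> h i y \<le> exp (t i)"
      "\<And>i. Ms (\<iota> i) x = density (Ms (\<iota> i) x') (\<lambda>y. ennreal (h i y))"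
      by metis
    interpret bounded_densities "{..<k}" "\<lambda>i. Ms (\<iota> i) x'" h "\<lambda>i. exp (t i - r (\<iota> i))" "\<lambda>i. exp (t i)"
    proof (rule bounded_densities.intro)
      show "prob_space (density (Ms (\<iota> i) x') (\<lambda>y. ennreal (h i y)))" for i
        using prob[of i x] unfolding h(3)[of i, symmetric] .
      show "0 \<le> exp (t i - r (\<iota> i)) \<and> exp (t i - r (\<iota> i)) < exp (t i)" for i
        using r_pos[of "\<iota> i"] by simp
    qed (simp_all add: prob h(1,2))
    have PP: "PP = M x"
      unfolding M_eq
    proof (intro PiM_cong refl)
      fix i assume "i \<in> {..<k}"
      then show "density (Ms (\<iota> i) x') (\<lambda>y. ennreal (h i y)) = Ms i x"
        using h(3)[of i] by (simp add: \<iota>_def)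
    qed
    have QQ: "QQ = M x'"
      unfolding M_eq by (intro PiM_cong refl) (simp add: \<iota>_def)
    have "S \<in> sets QQ"
      using S unfolding PP[symmetric] by (simp add: sets_PP)
    from measure_diff_le[OF this, of "exp \<epsilon>g"]
    have "measure (M x) S - exp \<epsilon>g * measure (M x') S
        \<le> rr_exp {..<k} (\<lambda>i. r (\<iota> i)) t (\<lambda>z. max 0 (z - exp \<epsilon>g))"
      unfolding PP QQ rr_exp_def .
    also have "rr_exp {..<k} (\<lambda>i. r (\<iota> i)) t (\<lambda>z. max 0 (z - exp \<epsilon>g)) = rr_exp {..<k} r t (\<lambda>z. max 0 (z - exp \<epsilon>g))"
      by (rule rr_exp_cong) (simp add: \<iota>_def)
    \<comment> \<open>Only the indices in \<open>B\<close> are averaged; at the DP indices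
      \<open>t i\<close> is already \<open>\<epsilon>\<close>.\<close>
    also have "\<exists>\<tau>\<ge>0. \<tau> \<le> \<epsilon> \<and> rr_exp {..<k} r t (\<lambda>z. max 0 (z - exp \<epsilon>g))
        \<le> rr_exp {..<k} r (\<lambda>i. if i \<in> B then \<tau> else t i) (\<lambda>z. max 0 (z - exp \<epsilon>g))"
    proof (rule rr_exp_equalize[OF finite_lessThan assms(6) convex_on_pos_part assms(2)])
      show "r i = \<epsilon>" if "i \<in> B" for i
        using that by (simp add: r_def)
      show "0 \<le> t i \<and> t i \<le> r i" if "i \<in> {..<k}" for i
        using t(1)[of i] that by (simp add: \<iota>_def)
    qed blast
    then obtain \<tau> where \<tau>: "0 \<le> \<tau>" "\<tau> \<le> \<epsilon>" and "rr_exp {..<k} r t (\<lambda>z. max 0 (z - exp \<epsilon>g))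
        \<le> rr_exp {..<k} r (\<lambda>i. if i \<in> B then \<tau> else t i) (\<lambda>z. max 0 (z - exp \<epsilon>g))"
      by blast
    note this(3)
    also have "rr_exp {..<k} r (\<lambda>i. if i \<in> B then \<tau> else t i) (\<lambda>z. max 0 (z - exp \<epsilon>g))
      = rr_exp {..<k} (\<lambda>i. if i \<in> B then \<epsilon> else 2 * \<epsilon>) (\<lambda>i. if i \<in> B then \<tau> else \<epsilon>) (\<lambda>z. max 0 (z - exp \<epsilon>g))"
      using t(2) by (intro rr_exp_cong) (auto simp: r_def \<iota>_def)
    also have "\<dots> = comp_delta k m \<epsilon> \<epsilon>g \<tau>"
      using assms(4,6,7) finite_subset[OF assms(6)]
      by (intro rr_exp_eq_comp_delta[OF _ assms(6,7) _ assms(4,2)]) (auto simp: card_Diff_subset)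
    also have "\<dots> \<le> (MAX l\<in>{0..k + m}. comp_delta k m \<epsilon> \<epsilon>g (t_pt k m \<epsilon> \<epsilon>g l))"
      by (rule comp_delta_le_Max[OF assms(4,2) \<tau>])
    finally show ?thesis
      by simp
  qed
  then show ?thesis
    by (simp add: is_DP_def)
qed

text \<open>Every factor is randomized response tilted at \<open>x\<close>, with parameter
  \<open>\<tau>\<close> on \<open>B\<close> and \<open>\<epsilon>\<close> elsewhere. Its likelihood
  ratios are two-valued, so the Neyman-Pearson event has excess exactly \<open>comp_delta\<close>
  and bounds every admissible \<open>\<delta>\<close> from below.\<close>

lemma composition_attains:
  fixes nb :: "'x \<Rightarrow> 'x \<Rightarrow> bool" and Cs :: "('x, 'y) mechanism set list"
  assumes "nb x x'" "x \<noteq> x'" "\<exists>y y' :: 'y. y \<noteq> y'" "0 < \<epsilon>" "m \<le> k" "length Cs = k" "B \<subseteq> {..<k}" "card B = k - m"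
    and Cs: "\<And>i. i < k \<Longrightarrow> Cs ! i = (if i \<in> B then BR_class nb \<epsilon> else DP_class nb \<epsilon>)"
    and \<tau>: "0 \<le> \<tau>" "\<tau> \<le> \<epsilon>"
  obtains M where "M \<in> composition Cs" "\<And>\<delta>. is_DP nb \<epsilon>g \<delta> M \<Longrightarrow> comp_delta k m \<epsilon> \<epsilon>g \<tau> \<le> \<delta>"
proof -
  define r where "r i = (if i \<in> B then \<epsilon> else 2 * \<epsilon>)" for i
  define t where "t i = (if i \<in> B then \<tau> else \<epsilon>)" for i
  have rt: "0 \<le> t i" "t i \<le> r i" "0 < r i" for i
    using assms(4) \<tau> by (auto simp: r_def t_def)
  obtain y y' :: 'y where "y \<noteq> y'"
    using assms(3) by blast
  have "\<exists>(Q :: 'y measure) h. prob_space Q \<and> h \<in> borel_measurable Q \<and> (\<forall>z. h z \<in> {exp (t i - r i), exp (t i)}) \<and>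
      prob_space (density Q (\<lambda>z. ennreal (h z)))" for i
    using randomized_response[OF \<open>y \<noteq> y'\<close> rt, of i] by metis
  then obtain Q :: "nat \<Rightarrow> 'y measure" and h where Q: "\<And>i. prob_space (Q i)"
    and h: "\<And>i. h i \<in> borel_measurable (Q i)" "\<And>i z. h i z \<in> {exp (t i - r i), exp (t i)}"
    and Qh: "\<And>i. prob_space (density (Q i) (\<lambda>z. ennreal (h i z)))"
    by metis
  interpret bounded_densities "{..<k}" Q h "\<lambda>i. exp (t i - r i)" "\<lambda>i. exp (t i)"
  proof (rule bounded_densities.intro)
    show "0 \<le> exp (t i - r i) \<and> exp (t i - r i) < exp (t i)" for i
      using rt[of i] by simp
    show "exp (t i - r i) \<le> h i y \<and> h i y \<le> exp (t i)" for i y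
      using h(2)[of i y] rt[of i] by auto
  qed (simp_all add: Q Qh h(1))
  define Ms where "Ms i z = density (Q i) (\<lambda>y. ennreal (if z = x then h i y else 1))" for i z
  define M where "M z = PiM {..<k} (\<lambda>i. Ms i z)" for z
  have "Ms i \<in> Cs ! i" if "i < k" for i
  proof (cases "i \<in> B")
    case True
    then show ?thesis
      using density_in_BR_class[OF Q[of i] h(1)[of i] Qh[of i], where t = \<tau> and \<epsilon> = \<epsilon>] h(2)[of i] Cs[OF that] assms(4)
      by (simp add: Ms_def[abs_def] r_def t_def)
  next
    case False
    then show ?thesis
      using density_in_DP_class[OF Q[of i] h(1)[of i] Qh[of i], where \<epsilon> = \<epsilon>] h(2)[of i] Cs[OF that] assms(4)
      by (simp add: Ms_def[abs_def] r_def t_def)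
  qed
  then have M_in: "M \<in> composition Cs"
    using assms(6) by (auto simp: composition_def M_def[abs_def])
  have PP: "PP = M x" and QQ: "QQ = M x'"
    using assms(2) by (simp_all add: M_def Ms_def density_1)
  obtain S where S: "S \<in> sets QQ"
    "measure PP S - exp \<epsilon>g * measure QQ S = rr_exp {..<k} r t (\<lambda>z. max 0 (z - exp \<epsilon>g))"
    using measure_diff_eq_two_point_exp[OF h(2), of "exp \<epsilon>g"] unfolding rr_exp_def by blast
  have "rr_exp {..<k} r t (\<lambda>z. max 0 (z - exp \<epsilon>g)) = comp_delta k m \<epsilon> \<epsilon>g \<tau>"
    unfolding r_def[abs_def] t_def[abs_def] using assms(5,7,8) finite_subset[OF assms(7)]
    by (intro rr_exp_eq_comp_delta[OF _ assms(7,8) _ assms(5,4)]) (auto simp: card_Diff_subset)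
  with S have eq: "measure (M x) S - exp \<epsilon>g * measure (M x') S = comp_delta k m \<epsilon> \<epsilon>g \<tau>"
    unfolding PP QQ by simp
  have "S \<in> sets (M x)"
    using S(1) unfolding PP[symmetric] by (simp add: sets_PP)
  then show thesis
    using eq assms(1) by (intro that[OF M_in]) (fastforce simp: is_DP_def)
qed

text \<open>The maximum \<open>D\<close> is reached at some \<open>l\<close>. The randomized
  response with parameter \<open>t_pt\<close> at this \<open>l\<close> has optimal value
  \<open>D\<close>, while \<open>D\<close> is admissible for every composition; the supremum is thus
  a maximum.\<close>

lemma delta_opt_class_composition:
  fixes nb :: "'x \<Rightarrow> 'x \<Rightarrow> bool" and Cs :: "('x, 'y) mechanism set list"
  assumes "symp nb" "nb x x'" "x \<noteq> x'" "\<exists>y y' :: 'y. y \<noteq> y'" "0 < \<epsilon>" "1 \<le> k" "m \<le> k"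
    and "length Cs = k" "B \<subseteq> {..<k}" "card B = k - m"
    and Cs: "\<And>i. i < k \<Longrightarrow> Cs ! i = (if i \<in> B then BR_class nb \<epsilon> else DP_class nb \<epsilon>)"
  shows "delta_opt_class nb (composition Cs) \<epsilon>g = (MAX l\<in>{0..k + m}. comp_delta k m \<epsilon> \<epsilon>g (t_pt k m \<epsilon> \<epsilon>g l))"
proof -
  define D where "D = (MAX l\<in>{0..k + m}. comp_delta k m \<epsilon> \<epsilon>g (t_pt k m \<epsilon> \<epsilon>g l))"
  have "D \<in> (\<lambda>l. comp_delta k m \<epsilon> \<epsilon>g (t_pt k m \<epsilon> \<epsilon>g l)) ` {0..k + m}"
    unfolding D_def by (intro Max_in) auto
  then obtain l where l: "D = comp_delta k m \<epsilon> \<epsilon>g (t_pt k m \<epsilon> \<epsilon>g l)"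
    by blast
  have D0: "0 \<le> D"
    unfolding l by (rule comp_delta_nonneg[OF assms(5) t_pt_bounds[OF assms(5)]])
  have DP: "is_DP nb \<epsilon>g D M" if "M \<in> composition Cs" for M
    unfolding D_def by (rule composition_is_DP[OF assms(1,5-10) Cs that])
  have le: "delta_opt nb M \<epsilon>g \<le> D" if "M \<in> composition Cs" for M
    unfolding delta_opt_def using D0 DP[OF that] by (intro cInf_lower bdd_belowI[of _ 0]) auto
  obtain M where M: "M \<in> composition Cs" "\<And>\<delta>. is_DP nb \<epsilon>g \<delta> M \<Longrightarrow> D \<le> \<delta>"
    using composition_attains[where \<tau> = "t_pt k m \<epsilon> \<epsilon>g l" and \<epsilon>g = \<epsilon>g,
        OF assms(2-5,7-10) Cs t_pt_bounds[OF assms(5)]]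
    unfolding l by blast
  have "D \<le> delta_opt nb M \<epsilon>g"
    unfolding delta_opt_def using D0 DP[OF M(1)] M(2) by (intro cInf_greatest) auto
  with le[OF M(1)] have "delta_opt nb M \<epsilon>g = D"
    by simp
  then show ?thesis
    unfolding delta_opt_class_def D_def[symmetric] using M(1) le
    by (intro cSup_eq_maximum) auto
qed

text \<open>This encodes an ordering of the factors by the set \<open>B\<close> of bounded-range
  positions. \<open>B\<close> is the preimage of the first \<open>n\<close> positions under a
  sorting permutation, so its size is \<open>n\<close> even if \<open>a = b\<close>.\<close>

lemma mset_replicate_append_nth:
  assumes "mset xs = mset (replicate n a @ replicate m b)"
  obtains B where "B \<subseteq> {..<n + m}" "card B = n" "\<And>i. i < n + m \<Longrightarrow> xs ! i = (if i \<in> B then a else b)"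
proof -
  let ?ys = "replicate n a @ replicate m b"
  obtain p where p: "p permutes {..<n + m}" "permute_list p ?ys = xs"
    using mset_eq_permutation[OF assms] by auto
  define B where "B = {i \<in> {..<n + m}. p i < n}"
  have "p ` B = {..<n}"
  proof (intro equalityI subsetI)
    fix j assume "j \<in> {..<n}"
    then have "j \<in> p ` {..<n + m}"
      unfolding permutes_image[OF p(1)] by simp
    then show "j \<in> p ` B"
      using \<open>j \<in> {..<n}\<close> by (auto simp: B_def)
  qed (auto simp: B_def)
  moreover have "inj_on p B"
    using permutes_inj[OF p(1)] by (rule inj_on_subset) simp
  ultimately have "card B = n"
    by (metis card_image card_lessThan)
  moreover have "xs ! i = (if i \<in> B then a else b)" if "i < n + m" for i
  proof -
    have "p i < n + m"
      using permutes_in_image[OF p(1), of i] that by simp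
    then show ?thesis
      using that p by (auto simp: B_def nth_append permute_list_nth simp flip: p(2))
  qed
  ultimately show thesis
    by (intro that[of B]) (auto simp: B_def)
qed

theorem theorem3:
  fixes nb :: "'x \<Rightarrow> 'x \<Rightarrow> bool"
    and k m :: nat
    and \<epsilon> \<epsilon>g :: real
    and BR DP :: "('x, 'y) mechanism set"
  defines "BR \<equiv> BR_class nb \<epsilon>"
    and "DP \<equiv> DP_class nb \<epsilon>"
  assumes "symp nb"
    and "\<exists>x x'. nb x x' \<and> x \<noteq> x'"
    and "\<exists>y y' :: 'y. y \<noteq> y'"
    and "1 \<le> k" and "m \<le> k"
    and "0 < \<epsilon>" and "0 < \<epsilon>g"
  shows "delta_opt_class nb (composition (replicate (k - m) BR @ replicate m DP)) \<epsilon>g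
           = (MAX l\<in>{0..k + m}. comp_delta k m \<epsilon> \<epsilon>g (t_pt k m \<epsilon> \<epsilon>g l))
       \<and> (\<forall>Cs. mset Cs = mset (replicate (k - m) BR @ replicate m DP) \<longrightarrow>
            delta_opt_class nb (composition Cs) \<epsilon>g
              = (MAX l\<in>{0..k + m}. comp_delta k m \<epsilon> \<epsilon>g (t_pt k m \<epsilon> \<epsilon>g l)))"
proof -
  obtain x x' where x: "nb x x'" "x \<noteq> x'"
    using assms(4) by blast
  \<comment> \<open>The displayed list is itself one of these orderings, so this claim yields both
    conjuncts.\<close>
  have "delta_opt_class nb (composition Cs) \<epsilon>g = (MAX l\<in>{0..k + m}. comp_delta k m \<epsilon> \<epsilon>g (t_pt k m \<epsilon> \<epsilon>g l))"
    if Cs: "mset Cs = mset (replicate (k - m) BR @ replicate m DP)" for Cs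
  proof -
    obtain B where B: "B \<subseteq> {..<k}" "card B = k - m" "\<And>i. i < k \<Longrightarrow> Cs ! i = (if i \<in> B then BR else DP)"
      using mset_replicate_append_nth[OF Cs] assms(7) by (metis le_add_diff_inverse2)
    have "length Cs = k"
      using mset_eq_length[OF Cs] assms(7) by simp
    then show ?thesis
      using B unfolding BR_def DP_def
      by (intro delta_opt_class_composition[OF assms(3) x assms(5,8,6,7)])
  qed
  then show ?thesis
    by blast
qed

end
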